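(* Let $G$ be the complement of a chain graph with bipartition $(X,Y)$, where $|X|=n$ and $|Y|=m$. Then $X$ and $Y$ are cliques of $G$, and removing the edges inside $X$ and inside $Y$ from $G$ leaves a chain graph $G^{\mathrm b}$. The number $p(G)$ of perfect matchings of $G$ is $$p(G)=\sum_{s=0}^{\min(n,m)} M(n,s)\cdot p(K_{n-s})\cdot p(K_{m-s}),$$ where $M(n,s)$ is the number of matchings of size exactly $s$ in $G^{\mathrm b}$. The values $M(i,s)$ are given by the recurrence $$M(i,0)=1\ (0\le i\le n),\qquad M(i,s)=0\ (0\le i<s\le n),$$ $$M(i,s)=M(i-1,s)+(\deg(x_i)-s+1)\,M(i-1,s-1)\quad(1\le s\le i\le n),$$ and can all be computed in $O(n^2)$ time; hence $p(G)$ can be computed in $O(n^2)$ time as well.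
   Context: A bipartite graph with bipartition $(X,Y)$ is a chain graph if for every pair of vertices $u,v\in X$ the neighbourhoods satisfy $\mathcal{N}(u)\subseteq\mathcal{N}(v)$ or $\mathcal{N}(u)\supseteq\mathcal{N}(v)$. Equivalently, the vertices of $X$ can be ordered $x_1,\ldots,x_n$ so that $\mathcal{N}(x_1)\subseteq\mathcal{N}(x_2)\subseteq\cdots\subseteq\mathcal{N}(x_n)$. In the recurrence, $x_1,\ldots,x_n$ is such an ordering for the chain graph $G^{\mathrm b}$, $\deg(x_i)$ is the degree of $x_i$ in $G^{\mathrm b}$, and $M(i,s)$ is the number of matchings of size exactly $s$ in the subgraph of $G^{\mathrm b}$ induced by $\{x_1,\ldots,x_i\}\cup Y$. For a graph $H$, $p(H)$ denotes the number of perfect matchings of $H$ (the empty graph has exactly one), and $K_t$ is the complete graph on $t$ vertices.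
   Formalization: For n=0, p(G)=p(K_m) cannot be computed in O(1), so the O(n²) time for p(G) is stated with the degrees deg(x_i) and the numbers p(K_t) given as input, and, from the adjacency matrix alone, as O(max(n,m)²). The M(i,s) are computed from n and the degrees, at unit cost per operation. *)

theory Defs
  imports Complex_Main "HOL-Library.Landau_Symbols"
begin

section \<open>Graphs, matchings and chain graphs\<close>

text \<open>A finite simple graph is given by a finite vertex set and a set of edges, each edge being a
  two-element set of vertices.\<close>

definition vpairs :: "'a set \<Rightarrow> 'a set set" where
  "vpairs V = {e. e \<subseteq> V \<and> card e = 2}"

definition complement_edges :: "'a set \<Rightarrow> 'a set set \<Rightarrow> 'a set set" where
  "complement_edges V E = vpairs V - E"

definition induced_edges :: "'a set set \<Rightarrow> 'a set \<Rightarrow> 'a set set" where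
  "induced_edges E U = {e \<in> E. e \<subseteq> U}"

definition clique :: "'a set set \<Rightarrow> 'a set \<Rightarrow> bool" where
  "clique E S \<longleftrightarrow> (\<forall>u\<in>S. \<forall>v\<in>S. u \<noteq> v \<longrightarrow> {u, v} \<in> E)"

definition nbhd :: "'a set set \<Rightarrow> 'a \<Rightarrow> 'a set" where
  "nbhd E u = {v. {u, v} \<in> E}"

definition degree :: "'a set set \<Rightarrow> 'a \<Rightarrow> nat" where
  "degree E u = card (nbhd E u)"

definition matching :: "'a set set \<Rightarrow> 'a set set \<Rightarrow> bool" where
  "matching E F \<longleftrightarrow> F \<subseteq> E \<and> (\<forall>e\<in>F. \<forall>f\<in>F. e \<noteq> f \<longrightarrow> e \<inter> f = {})"

definition num_matchings :: "'a set set \<Rightarrow> nat \<Rightarrow> nat" where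
  "num_matchings E s = card {F. matching E F \<and> card F = s}"

definition num_perfect_matchings :: "'a set \<Rightarrow> 'a set set \<Rightarrow> nat" where
  "num_perfect_matchings V E = card {F. matching E F \<and> \<Union>F = V}"

definition pK :: "nat \<Rightarrow> nat" where
  "pK t = num_perfect_matchings {0..<t} (vpairs {0..<t})"

definition bipartite_graph :: "'a set \<Rightarrow> 'a set \<Rightarrow> 'a set set \<Rightarrow> bool" where
  "bipartite_graph X Y E \<longleftrightarrow> finite X \<and> finite Y \<and> X \<inter> Y = {} \<and>
     E \<subseteq> {{x, y} | x y. x \<in> X \<and> y \<in> Y}"

definition chain_graph :: "'a set \<Rightarrow> 'a set \<Rightarrow> 'a set set \<Rightarrow> bool" where
  "chain_graph X Y E \<longleftrightarrow> bipartite_graph X Y E \<and>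
     (\<forall>u\<in>X. \<forall>v\<in>X. nbhd E u \<subseteq> nbhd E v \<or> nbhd E v \<subseteq> nbhd E u)"

definition cochain_graph :: "'a set \<Rightarrow> 'a set \<Rightarrow> 'a set set \<Rightarrow> bool" where
  "cochain_graph X Y E \<longleftrightarrow> (\<exists>H. chain_graph X Y H \<and> E = complement_edges (X \<union> Y) H)"

text \<open>The graph \<open>G\<^sup>b\<close>.\<close>

definition cross_edges :: "'a set \<Rightarrow> 'a set \<Rightarrow> 'a set set \<Rightarrow> 'a set set" where
  "cross_edges X Y E = E - {e. e \<subseteq> X} - {e. e \<subseteq> Y}"

definition chain_ordering :: "'a set \<Rightarrow> 'a set set \<Rightarrow> (nat \<Rightarrow> 'a) \<Rightarrow> bool" where
  "chain_ordering X E x \<longleftrightarrow> bij_betw x {1..card X} X \<and>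
     (\<forall>i j. 1 \<le> i \<and> i \<le> j \<and> j \<le> card X \<longrightarrow> nbhd E (x i) \<subseteq> nbhd E (x j))"

text \<open>The number \<open>M(i,s)\<close>, for the graph \<open>G\<^sup>b\<close> with edge set \<open>B\<close> and the ordering \<open>x\<close>.\<close>

definition matching_count :: "'a set \<Rightarrow> 'a set set \<Rightarrow> (nat \<Rightarrow> 'a) \<Rightarrow> nat \<Rightarrow> nat \<Rightarrow> nat" where
  "matching_count Y B x i s = num_matchings (induced_edges B (x ` {1..i} \<union> Y)) s"


section \<open>Model of computation\<close>

text \<open>Running times refer to while programs on integer arrays with unit-cost arithmetic
  (addition, subtraction, multiplication, comparison) and unit-cost array access. A scalar is the
  cell with index 0 of an array. Every evaluation of an operand or operator costs 1, and so
  does every assignment, test and skip.\<close>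

type_synonym store = "string \<Rightarrow> int \<Rightarrow> int"

datatype expr =
    Const int
  | Cell string expr
  | Plus expr expr
  | Minus expr expr
  | Times expr expr

datatype com =
    Skip
  | Assign string expr expr
  | Seq com com
  | IfLess expr expr com com
  | WhileLess expr expr com

primrec eval_expr :: "expr \<Rightarrow> store \<Rightarrow> int" where
  "eval_expr (Const k) \<sigma> = k"
| "eval_expr (Cell a e) \<sigma> = \<sigma> a (eval_expr e \<sigma>)"
| "eval_expr (Plus e f) \<sigma> = eval_expr e \<sigma> + eval_expr f \<sigma>"
| "eval_expr (Minus e f) \<sigma> = eval_expr e \<sigma> - eval_expr f \<sigma>"
| "eval_expr (Times e f) \<sigma> = eval_expr e \<sigma> * eval_expr f \<sigma>"

primrec expr_cost :: "expr \<Rightarrow> nat" where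
  "expr_cost (Const k) = 1"
| "expr_cost (Cell a e) = 1 + expr_cost e"
| "expr_cost (Plus e f) = 1 + expr_cost e + expr_cost f"
| "expr_cost (Minus e f) = 1 + expr_cost e + expr_cost f"
| "expr_cost (Times e f) = 1 + expr_cost e + expr_cost f"

text \<open>\<open>exec c \<sigma> t \<tau>\<close>: started in \<open>\<sigma>\<close>, the program \<open>c\<close> halts in \<open>\<tau>\<close> after exactly \<open>t\<close> steps.\<close>

inductive exec :: "com \<Rightarrow> store \<Rightarrow> nat \<Rightarrow> store \<Rightarrow> bool" where
  Skip: "exec Skip \<sigma> 1 \<sigma>"
| Assign: "exec (Assign a e f) \<sigma> (1 + expr_cost e + expr_cost f)
     (\<sigma>(a := (\<sigma> a)(eval_expr e \<sigma> := eval_expr f \<sigma>)))"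
| Seq: "\<lbrakk>exec c \<sigma> t \<sigma>'; exec d \<sigma>' u \<sigma>''\<rbrakk> \<Longrightarrow> exec (Seq c d) \<sigma> (t + u) \<sigma>''"
| IfTrue: "\<lbrakk>eval_expr e \<sigma> < eval_expr f \<sigma>; exec c \<sigma> t \<sigma>'\<rbrakk> \<Longrightarrow>
     exec (IfLess e f c d) \<sigma> (1 + expr_cost e + expr_cost f + t) \<sigma>'"
| IfFalse: "\<lbrakk>\<not> eval_expr e \<sigma> < eval_expr f \<sigma>; exec d \<sigma> t \<sigma>'\<rbrakk> \<Longrightarrow>
     exec (IfLess e f c d) \<sigma> (1 + expr_cost e + expr_cost f + t) \<sigma>'"
| WhileFalse: "\<not> eval_expr e \<sigma> < eval_expr f \<sigma> \<Longrightarrow>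
     exec (WhileLess e f c) \<sigma> (1 + expr_cost e + expr_cost f) \<sigma>"
| WhileTrue: "\<lbrakk>eval_expr e \<sigma> < eval_expr f \<sigma>; exec c \<sigma> t \<sigma>'; exec (WhileLess e f c) \<sigma>' u \<sigma>''\<rbrakk> \<Longrightarrow>
     exec (WhileLess e f c) \<sigma> (1 + expr_cost e + expr_cost f + t + u) \<sigma>''"

definition runs_within :: "com \<Rightarrow> store \<Rightarrow> nat \<Rightarrow> (store \<Rightarrow> bool) \<Rightarrow> bool" where
  "runs_within c \<sigma> b Q \<longleftrightarrow> (\<exists>t \<tau>. exec c \<sigma> t \<tau> \<and> t \<le> b \<and> Q \<tau>)"

text \<open>Initial stores. All cells outside the input are 0.\<close>

definition zero_store :: store where
  "zero_store = (\<lambda>a k. 0)"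

definition scalar_input :: "string \<Rightarrow> nat \<Rightarrow> store \<Rightarrow> store" where
  "scalar_input a v \<sigma> = \<sigma>(a := (\<sigma> a)(0 := int v))"

definition array_input :: "string \<Rightarrow> nat set \<Rightarrow> (nat \<Rightarrow> nat) \<Rightarrow> store \<Rightarrow> store" where
  "array_input a I f \<sigma> =
     \<sigma>(a := (\<lambda>k. if 0 \<le> k \<and> nat k \<in> I then int (f (nat k)) else \<sigma> a k))"

text \<open>The degrees \<open>d 1, \<dots>, d n\<close> of \<open>x\<^sub>1, \<dots>, x\<^sub>n\<close> in \<open>G\<^sup>b\<close>.\<close>

definition degree_input :: "nat \<Rightarrow> (nat \<Rightarrow> nat) \<Rightarrow> store" where
  "degree_input n d = scalar_input ''n'' n (array_input ''deg'' {1..n} d zero_store)"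

text \<open>In addition \<open>m\<close> and the numbers \<open>p(K\<^sub>t)\<close> occurring in the formula for \<open>p(G)\<close>. For
  \<open>m\<close> large compared with \<open>n\<close> the latter cannot be computed in time bounded in terms of \<open>n\<close> alone
  (if \<open>n = 0\<close>, then \<open>p(G) = p(K\<^sub>m)\<close>), so a bound in \<open>n\<close> has to take them as known.\<close>

definition degree_pK_input :: "nat \<Rightarrow> nat \<Rightarrow> (nat \<Rightarrow> nat) \<Rightarrow> store" where
  "degree_pK_input n m d =
     scalar_input ''m'' m (array_input ''pK'' {0..max n m} pK (degree_input n d))"

text \<open>The adjacency matrix of a graph on \<open>{0..<n+m}\<close>, stored row by row.\<close>

definition adjacency_input :: "nat \<Rightarrow> nat \<Rightarrow> nat set set \<Rightarrow> store" where
  "adjacency_input n m E =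
     scalar_input ''n'' n (scalar_input ''m'' m
       (array_input ''adj'' {0..<(n + m) * (n + m)}
         (\<lambda>k. if {k div (n + m), k mod (n + m)} \<in> E then 1 else 0) zero_store))"

end

(* A perfect matching F of G is determined by its set C of cross edges together with perfect matchings
   of the cliques X and Y minus the vertices covered by C. If C has s edges, it covers s vertices on
   either side, so there are p(K_(n-s)) p(K_(m-s)) such completions.

   For the recurrence, a matching of size s using x_i consists of a matching of size s-1 on
   x_1, ..., x_(i-1) and an uncovered neighbour of x_i. The chain condition puts all s-1 covered
   vertices of Y inside N(x_i), which leaves deg(x_i) - s + 1 choices.

   From the adjacency matrix, the ordered degrees of X are obtained without sorting, as the conjugate
   of the degree sequence of Y, and the numbers p(K_t) by p(K_(t+2)) = (t+1) p(K_t). *)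

theory Submission
  imports Defs
begin

section \<open>Matchings in cochain graphs\<close>

text \<open>In a general bipartite graph, the number of ways to extend a matching by an edge at a
  new vertex depends on which of its neighbours are already covered. The chain condition removes
  this dependence: the neighbourhoods of all earlier vertices lie in that of the new vertex, so the
  old subgraph has this neighbourhood as its second side, and every matching of size
  \<open>k\<close> covers exactly \<open>k\<close> vertices of it. The factor
  \<open>deg(x_i) - s + 1\<close> can be negative, which is why the recurrence lives in the
  integers; in that case no matching of size \<open>s - 1\<close> exists among the earlier vertices
  and the product is 0. For the running times, counting is kept apart from execution: the table and
  the final sum are verified for arbitrary integer functions with the required recurrence and zeros,
  and the graph lemmas supply these properties afterwards. All loops are counting loops whose
  invariant keeps the limit fixed, so a bound for one round times the number of rounds bounds the
  time.\<close>

abbreviation complete_pms :: "'a set \<Rightarrow> 'a set set set" where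
  "complete_pms V \<equiv> {F. matching (vpairs V) F \<and> \<Union>F = V}"

lemma matching_vpairs_iff:
  "matching (vpairs V) F \<and> \<Union>F = V \<longleftrightarrow>
     (\<forall>e\<in>F. card e = 2) \<and> (\<forall>e\<in>F. \<forall>f\<in>F. e \<noteq> f \<longrightarrow> e \<inter> f = {}) \<and> \<Union>F = V"
  unfolding matching_def vpairs_def by auto

lemma finite_vpairs: "finite V \<Longrightarrow> finite (vpairs V)"
  unfolding vpairs_def by simp

lemma finite_matchings: "finite E \<Longrightarrow> finite {F. matching E F \<and> Q F}"
  by (rule finite_subset[of _ "Pow E"]) (auto simp: matching_def)

text \<open>Classification by the partner \<open>w\<close> of the fixed vertex \<open>v\<close>:
  deleting the edge at \<open>v\<close> leaves a perfect matching of the remaining vertices, and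
  inserting it again undoes this.\<close>

lemma complete_pms_decompose:
  assumes "v \<in> V"
  shows "complete_pms V = (\<Union>w\<in>V - {v}. insert {v, w} ` complete_pms (V - {v, w}))"
proof (intro equalityI subsetI)
  fix F assume "F \<in> complete_pms V"
  hence c: "\<forall>e\<in>F. card e = 2" and d: "\<forall>e\<in>F. \<forall>f\<in>F. e \<noteq> f \<longrightarrow> e \<inter> f = {}" and u: "\<Union>F = V"
    using matching_vpairs_iff[of V F] by auto
  obtain e where e: "e \<in> F" "v \<in> e" using u assms by auto
  obtain w where w: "e = {v, w}" "w \<noteq> v"
    using c e by (metis card_2_iff doubleton_eq_iff insertE singletonD)
  have "\<Union>(F - {e}) = \<Union>F - e" using d e(1) by blast
  hence "\<Union>(F - {e}) = V - {v, w}" using u w(1) by simp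
  hence "F - {e} \<in> complete_pms (V - {v, w})"
    using c d by (auto simp: matching_vpairs_iff)
  moreover have "F = insert {v, w} (F - {e})" using e w by auto
  moreover have "w \<in> V - {v}" using e w u by auto
  ultimately show "F \<in> (\<Union>w\<in>V - {v}. insert {v, w} ` complete_pms (V - {v, w}))" by blast
next
  fix F assume "F \<in> (\<Union>w\<in>V - {v}. insert {v, w} ` complete_pms (V - {v, w}))"
  then obtain w F' where w: "w \<in> V" "w \<noteq> v" "F = insert {v, w} F'" "F' \<in> complete_pms (V - {v, w})"
    by auto
  hence F': "\<forall>e\<in>F'. card e = 2" "\<forall>e\<in>F'. \<forall>f\<in>F'. e \<noteq> f \<longrightarrow> e \<inter> f = {}" "\<Union>F' = V - {v, w}"
    using matching_vpairs_iff[of "V - {v,w}" F'] by auto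
  hence "\<forall>e\<in>F'. e \<inter> {v, w} = {}" by auto
  hence "\<forall>e\<in>F. \<forall>f\<in>F. e \<noteq> f \<longrightarrow> e \<inter> f = {}" using F'(2) w(3) by (metis Int_commute insertE)
  moreover have "\<forall>e\<in>F. card e = 2" using F' w by auto
  moreover have "\<Union>F = V" using F' w assms by auto
  ultimately show "F \<in> complete_pms V" by (simp add: matching_vpairs_iff)
qed

lemma num_perfect_matchings_complete_rec:
  assumes "finite V" "v \<in> V"
  shows "num_perfect_matchings V (vpairs V) =
    (\<Sum>w\<in>V - {v}. num_perfect_matchings (V - {v, w}) (vpairs (V - {v, w})))"
proof -
  have ni: "{v, w} \<notin> F" if "F \<in> complete_pms (V - {v, w})" for w F using that by auto
  have "card (complete_pms V) = (\<Sum>w\<in>V - {v}. card (insert {v, w} ` complete_pms (V - {v, w})))"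
    unfolding complete_pms_decompose[OF assms(2)]
  proof (rule card_UN_disjoint)
    show "\<forall>w\<in>V - {v}. finite (insert {v, w} ` complete_pms (V - {v, w}))"
      using assms by (auto intro!: finite_imageI finite_matchings finite_vpairs)
    show "\<forall>w\<in>V - {v}. \<forall>w'\<in>V - {v}. w \<noteq> w' \<longrightarrow>
      insert {v, w} ` complete_pms (V - {v, w}) \<inter> insert {v, w'} ` complete_pms (V - {v, w'}) = {}"
    proof (intro ballI impI, rule ccontr)
      fix w w' assume w: "w \<in> V - {v}" "w' \<in> V - {v}" "w \<noteq> w'"
        and "insert {v, w} ` complete_pms (V - {v, w}) \<inter> insert {v, w'} ` complete_pms (V - {v, w'}) \<noteq> {}"
      then obtain F F' where F: "F \<in> complete_pms (V - {v, w})" "insert {v, w} F = insert {v, w'} F'"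
        by auto
      \<comment> \<open>The edges \<open>{v, w}\<close> and \<open>{v, w'}\<close> differ, so the
        second would already lie in \<open>F\<close>, which does not cover \<open>v\<close>.\<close>
      have "{v, w'} \<in> F" using F(2) w by (metis doubleton_eq_iff insert_iff)
      thus False using F(1) by auto
    qed
  qed (use assms in auto)
  also have "\<dots> = (\<Sum>w\<in>V - {v}. card (complete_pms (V - {v, w})))"
  proof (rule sum.cong[OF refl], rule card_image)
    fix w show "inj_on (insert {v, w}) (complete_pms (V - {v, w}))"
      using ni by (meson inj_onI insert_ident)
  qed
  finally show ?thesis unfolding num_perfect_matchings_def .
qed

text \<open>The double factorial \<open>(t - 1)!!\<close> for even \<open>t\<close>, and 0 for odd
  \<open>t\<close>: a vertex of the complete graph on \<open>t + 2\<close> vertices has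
  \<open>t + 1\<close> possible partners.\<close>

fun complete_pm_count :: "nat \<Rightarrow> nat" where
  "complete_pm_count 0 = 1"
| "complete_pm_count (Suc 0) = 0"
| "complete_pm_count (Suc (Suc t)) = Suc t * complete_pm_count t"

lemma num_perfect_matchings_complete:
  "finite V \<Longrightarrow> num_perfect_matchings V (vpairs V) = complete_pm_count (card V)"
proof (induction "card V" arbitrary: V rule: less_induct)
  case less
  show ?case
  proof (cases "V = {}")
    case True
    have "complete_pms ({} :: 'a set) = {{}}" by (auto simp: matching_def vpairs_def)
    thus ?thesis using True by (simp add: num_perfect_matchings_def)
  next
    case False
    then obtain v where v: "v \<in> V" by auto
    have c: "card (V - {v, w}) = card V - 2" if "w \<in> V - {v}" for w
      using that v less.prems by (subst card_Diff_subset) auto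
    have "num_perfect_matchings V (vpairs V) =
      (\<Sum>w\<in>V - {v}. num_perfect_matchings (V - {v, w}) (vpairs (V - {v, w})))"
      by (rule num_perfect_matchings_complete_rec[OF less.prems v])
    also have "\<dots> = (\<Sum>w\<in>V - {v}. complete_pm_count (card V - 2))"
    proof (rule sum.cong[OF refl])
      fix w assume w: "w \<in> V - {v}"
      have "card (V - {v, w}) < card V" by (rule psubset_card_mono) (use v less.prems in auto)
      thus "num_perfect_matchings (V - {v, w}) (vpairs (V - {v, w})) = complete_pm_count (card V - 2)"
        using less.hyps less.prems c[OF w] by simp
    qed
    also have "\<dots> = (card V - 1) * complete_pm_count (card V - 2)"
      using v by simp
    \<comment> \<open>For a single vertex the factor \<open>card V - 1\<close> is 0, so the
      truncated subtraction in \<open>card V - 2\<close> does no harm.\<close>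
    also have "\<dots> = complete_pm_count (card V)"
      using False less.prems by (cases "card V" rule: complete_pm_count.cases) auto
    finally show ?thesis .
  qed
qed

lemma pK_eq: "pK t = complete_pm_count t"
  unfolding pK_def by (simp add: num_perfect_matchings_complete)

lemma pK_rec: "pK 0 = 1" "pK (Suc 0) = 0" "pK (Suc (Suc t)) = Suc t * pK t"
  by (simp_all add: pK_eq)

lemma num_perfect_matchings_complete_pK:
  "finite V \<Longrightarrow> num_perfect_matchings V (vpairs V) = pK (card V)"
  by (simp add: pK_eq num_perfect_matchings_complete)

section \<open>Matchings of bipartite graphs\<close>

lemma bipartite_graph_finite:
  assumes "bipartite_graph X Y E" shows "finite E"
proof -
  have "E \<subseteq> (\<lambda>(x, y). {x, y}) ` (X \<times> Y)" using assms unfolding bipartite_graph_def by auto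
  thus ?thesis using assms unfolding bipartite_graph_def by (meson finite_SigmaI finite_imageI finite_subset)
qed

lemma bipartite_graph_swap: "bipartite_graph X Y E \<Longrightarrow> bipartite_graph Y X E"
proof -
  assume bip: "bipartite_graph X Y E"
  have "\<exists>y x. e = {y, x} \<and> y \<in> Y \<and> x \<in> X" if "e \<in> E" for e
    using that bip unfolding bipartite_graph_def by blast
  thus ?thesis using bip unfolding bipartite_graph_def by blast
qed

lemma bipartite_nbhd: "bipartite_graph X Y E \<Longrightarrow> u \<in> X \<Longrightarrow> nbhd E u \<subseteq> Y"
  unfolding bipartite_graph_def nbhd_def by (auto simp: doubleton_eq_iff dest!: subsetD)

text \<open>Every edge has exactly one end in \<open>Y\<close>, and the edges of a matching are
  disjoint. The lemma is used with the neighbourhood of a new vertex in the role of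
  \<open>Y\<close>, and for \<open>X\<close> after swapping the sides.\<close>

lemma card_matched_vertices:
  assumes "bipartite_graph X Y E" "matching E F"
  shows "card (Y \<inter> \<Union>F) = card F"
proof -
  have "F \<subseteq> E" "finite Y" and dis: "X \<inter> Y = {}"
    using assms unfolding matching_def bipartite_graph_def by simp_all
  hence fin: "finite F" "finite Y"
    using bipartite_graph_finite[OF assms(1)] finite_subset[of F E] by simp_all
  have one: "card (Y \<inter> e) = 1" if "e \<in> F" for e
  proof -
    have "e \<in> E" using that \<open>F \<subseteq> E\<close> by auto
    then obtain x y where "e = {x, y}" "x \<in> X" "y \<in> Y"
      using assms(1) unfolding bipartite_graph_def by blast
    hence "Y \<inter> e = {y}" using dis by auto
    thus ?thesis by simp
  qed
  have "card (Y \<inter> \<Union>F) = card (\<Union>e\<in>F. Y \<inter> e)" by (simp only: Int_Union)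
  also have "\<dots> = (\<Sum>e\<in>F. card (Y \<inter> e))"
    by (rule card_UN_disjoint) (use fin assms(2) in \<open>auto simp: matching_def\<close>)
  finally show ?thesis using one by simp
qed

lemma bipartite_matching_card_le:
  assumes "bipartite_graph X Y E" "matching E F"
  shows "card F \<le> card Y"
  using card_matched_vertices[OF assms] assms(1)
  by (metis Int_lower1 bipartite_graph_def card_mono)

text \<open>The first side yields the zeros \<open>M(i,s)\<close> for \<open>i < s\<close>; the
  second makes the terms with \<open>s > m\<close> vanish when the program sums up to
  \<open>n\<close>.\<close>

lemma num_matchings_eq_0:
  assumes "bipartite_graph X Y E" "card X < s \<or> card Y < s"
  shows "num_matchings E s = 0"
proof -
  have "{F. matching E F \<and> card F = s} = {}"
    using bipartite_matching_card_le[OF assms(1)] bipartite_matching_card_le[OF bipartite_graph_swap[OF assms(1)]]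
      assms(2) by fastforce
  thus ?thesis unfolding num_matchings_def by (metis card.empty)
qed

lemma num_matchings_0: "finite E \<Longrightarrow> num_matchings E 0 = 1"
proof -
  assume "finite E"
  hence "{F. matching E F \<and> card F = 0} = {{}}"
    by (auto simp: matching_def dest: finite_subset)
  thus ?thesis unfolding num_matchings_def by simp
qed

text \<open>Every matching of \<open>E\<close> covers only neighbours of the new vertex \<open>v\<close>, so a matching of size \<open>s\<close>
  leaves exactly \<open>card N - s\<close> partners for \<open>v\<close>.\<close>

lemma num_matchings_dominating_vertex:
  assumes bip: "bipartite_graph X N E" and v: "v \<notin> X" "v \<notin> N"
  shows "int (num_matchings (E \<union> {{v, y} | y. y \<in> N}) (Suc s)) =
    int (num_matchings E (Suc s)) + (int (card N) - int s) * int (num_matchings E s)"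
proof -
  define E' where "E' = E \<union> {{v, y} | y. y \<in> N}"
  define S where "S = {F. matching E F \<and> card F = s}"
  define A where "A = {F. matching E F \<and> card F = Suc s}"
  \<comment> \<open>Matchings that use \<open>v\<close>, encoded by the matching that remains
    without the edge at \<open>v\<close> together with the partner of \<open>v\<close>.\<close>
  define C where "C = (\<lambda>(F, y). insert {v, y} F) ` (SIGMA F:S. N - \<Union>F)"
  have fE: "finite E" and fN: "finite N"
    using bip bipartite_graph_finite unfolding bipartite_graph_def by auto
  have vE: "v \<notin> e" if "e \<in> E" for e
    using bip v that unfolding bipartite_graph_def by blast
  have finF: "finite F" if "matching E F" for F
    using that fE finite_subset unfolding matching_def by auto
  have "{F. matching E' F \<and> card F = Suc s} = A \<union> C"
  proof (intro equalityI subsetI)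
    fix F assume "F \<in> {F. matching E' F \<and> card F = Suc s}"
    hence sub: "F \<subseteq> E'" and d: "\<And>e f. e \<in> F \<Longrightarrow> f \<in> F \<Longrightarrow> e \<noteq> f \<Longrightarrow> e \<inter> f = {}"
      and card: "card F = Suc s" by (auto simp: matching_def)
    show "F \<in> A \<union> C"
    proof (cases "F \<subseteq> E")
      case True
      thus ?thesis using d card by (auto simp: A_def matching_def)
    next
      case False
      then obtain y where y: "{v, y} \<in> F" "y \<in> N" using sub unfolding E'_def by blast
      define F' where "F' = F - {{v, y}}"
      have dis: "e \<inter> {v, y} = {}" if "e \<in> F'" for e using that d y unfolding F'_def by blast
      \<comment> \<open>A second new edge would also contain \<open>v\<close> and meet
        \<open>{v, y}\<close>.\<close>
      have "F' \<subseteq> E" using sub dis unfolding E'_def F'_def by blast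
      moreover have "card F' = s" using card y unfolding F'_def by simp
      ultimately have "F' \<in> S" using d unfolding S_def matching_def F'_def by auto
      moreover have "y \<in> N - \<Union>F'" using y dis by auto
      moreover have "F = insert {v, y} F'" using y unfolding F'_def by auto
      ultimately show ?thesis unfolding C_def by force
    qed
  next
    fix F assume "F \<in> A \<union> C"
    thus "F \<in> {F. matching E' F \<and> card F = Suc s}"
    proof
      assume "F \<in> A"
      thus ?thesis by (auto simp: A_def matching_def E'_def)
    next
      assume "F \<in> C"
      then obtain F' y where F: "F = insert {v, y} F'" "F' \<in> S" "y \<in> N" "y \<notin> \<Union>F'"
        unfolding C_def by auto
      hence m: "matching E F'" "card F' = s" by (auto simp: S_def)
      have dis: "e \<inter> {v, y} = {}" if "e \<in> F'" for e
        using that F m vE unfolding matching_def by auto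
      have "{v, y} \<notin> F'" using dis by blast
      hence "card F = Suc s" using F(1) m finF by simp
      moreover have "matching E' F"
        using m dis F unfolding matching_def E'_def by (auto 4 3)
      ultimately show ?thesis by simp
    qed
  qed
  moreover have "A \<inter> C = {}"
    using vE unfolding A_def C_def matching_def by auto
  moreover have fA: "finite A" "finite S" unfolding A_def S_def by (auto intro: finite_matchings fE)
  moreover have "finite C" unfolding C_def using fA fN by auto
  ultimately have "num_matchings E' (Suc s) = card A + card C"
    unfolding num_matchings_def by (simp add: card_Un_disjoint)
  moreover have "card C = (\<Sum>F\<in>S. card (N - \<Union>F))"
  proof -
    \<comment> \<open>The inserted edge can be recovered as the only one that contains
      \<open>v\<close>.\<close>
    have "inj_on (\<lambda>(F, y). insert {v, y} F) (SIGMA F:S. N - \<Union>F)"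
    proof (rule inj_onI, clarify)
      fix F y F' y' assume *: "F \<in> S" "F' \<in> S" "y \<in> N" "y' \<in> N" "insert {v, y} F = insert {v, y'} F'"
      have n: "{v, z} \<notin> F" "{v, z} \<notin> F'" for z using * vE unfolding S_def matching_def by auto
      have "{v, y} = {v, y'}" using * n by (metis insert_iff)
      hence "y = y'" by (auto simp: doubleton_eq_iff)
      moreover have "F = F'" using * n calculation by (metis insert_ident)
      ultimately show "F = F' \<and> y = y'" by simp
    qed
    thus ?thesis unfolding C_def using fA fN by (simp add: card_image card_SigmaI)
  qed
  \<comment> \<open>The subtraction is exact for every member of \<open>S\<close>. If
    \<open>card N < s\<close>, then \<open>S\<close> is empty and the negative factor is multiplied
    by 0.\<close>
  moreover have "int (card (N - \<Union>F)) = int (card N) - int s" if "F \<in> S" for F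
  proof -
    have "card (N \<inter> \<Union>F) = s" using that card_matched_vertices[OF bip] unfolding S_def by auto
    moreover have "card (N - \<Union>F) = card N - card (N \<inter> \<Union>F)"
      by (metis card_Diff_subset_Int fN finite_Int)
    moreover have "card (N \<inter> \<Union>F) \<le> card N" using fN by (simp add: card_mono)
    ultimately show ?thesis by simp
  qed
  ultimately show ?thesis
    unfolding num_matchings_def A_def[symmetric] S_def[symmetric] E'_def by simp
qed

section \<open>Splitting perfect matchings along the cross edges\<close>

text \<open>Each edge lies inside \<open>X\<close>, inside \<open>Y\<close>, or in the cross part,
  and in only one of them, so \<open>F\<close> is recovered from its three pieces. Once
  \<open>C\<close> is fixed, the two pieces inside the cliques can be chosen independently.\<close>

lemma perfect_matchings_with_cross_edges:
  assumes X: "X \<inter> Y = {}"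
    and E: "E \<inter> {e. e \<subseteq> X} = vpairs X" "E \<inter> {e. e \<subseteq> Y} = vpairs Y"
    and C: "matching (cross_edges X Y E) C" "\<Union>C \<subseteq> X \<union> Y"
  shows "bij_betw (\<lambda>(P, Q). C \<union> P \<union> Q) (complete_pms (X - \<Union>C) \<times> complete_pms (Y - \<Union>C))
    {F. matching E F \<and> \<Union>F = X \<union> Y \<and> F \<inter> cross_edges X Y E = C}"
proof -
  let ?B = "cross_edges X Y E"
  have sp: "e \<in> E \<Longrightarrow> e \<in> ?B \<or> e \<in> vpairs X \<or> e \<in> vpairs Y" for e
    using E unfolding cross_edges_def by blast
  \<comment> \<open>Only the empty set could lie inside both of the disjoint sides.\<close>
  have ne: "e \<noteq> {}" if "e \<in> vpairs V" for e and V :: "'a set" using that unfolding vpairs_def by auto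
  have vm: "vpairs U \<subseteq> vpairs V" if "U \<subseteq> V" for U V :: "'a set" using that unfolding vpairs_def by auto
  have EX: "vpairs X \<subseteq> E" "vpairs Y \<subseteq> E" using E by auto
  have BX: "e \<notin> ?B" if "e \<subseteq> X \<or> e \<subseteq> Y" for e using that unfolding cross_edges_def by auto
  have CE: "C \<subseteq> E" using C unfolding matching_def cross_edges_def by auto
  have dC: "\<And>e f. e \<in> C \<Longrightarrow> f \<in> C \<Longrightarrow> e \<noteq> f \<Longrightarrow> e \<inter> f = {}" using C unfolding matching_def by auto
  show ?thesis
  proof (rule bij_betw_byWitness[where f' = "\<lambda>F. (F \<inter> {e. e \<subseteq> X}, F \<inter> {e. e \<subseteq> Y})"])
    have "(C \<union> P \<union> Q) \<inter> {e. e \<subseteq> X} = P \<and> (C \<union> P \<union> Q) \<inter> {e. e \<subseteq> Y} = Q"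
      if P: "P \<in> complete_pms (X - \<Union>C)" and Q: "Q \<in> complete_pms (Y - \<Union>C)" for P Q
    proof -
      have "e \<subseteq> X \<and> \<not> e \<subseteq> Y" if "e \<in> P" for e
      proof -
        have "e \<in> vpairs (X - \<Union>C)" using that P unfolding matching_def by auto
        thus ?thesis using ne[of e] X unfolding vpairs_def by blast
      qed
      moreover have "e \<subseteq> Y \<and> \<not> e \<subseteq> X" if "e \<in> Q" for e
      proof -
        have "e \<in> vpairs (Y - \<Union>C)" using that Q unfolding matching_def by auto
        thus ?thesis using ne[of e] X unfolding vpairs_def by blast
      qed
      moreover have "\<not> e \<subseteq> X \<and> \<not> e \<subseteq> Y" if "e \<in> C" for e
        using that C BX[of e] unfolding matching_def by auto
      ultimately show ?thesis by blast
    qed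
    thus "\<forall>a\<in>complete_pms (X - \<Union>C) \<times> complete_pms (Y - \<Union>C).
       (\<lambda>F. (F \<inter> {e. e \<subseteq> X}, F \<inter> {e. e \<subseteq> Y})) ((\<lambda>(P, Q). C \<union> P \<union> Q) a) = a" by auto
    show "\<forall>F\<in>{F. matching E F \<and> \<Union>F = X \<union> Y \<and> F \<inter> ?B = C}.
      (\<lambda>(P, Q). C \<union> P \<union> Q) ((\<lambda>F. (F \<inter> {e. e \<subseteq> X}, F \<inter> {e. e \<subseteq> Y})) F) = F"
      unfolding matching_def cross_edges_def by auto
    have "C \<union> P \<union> Q \<in> {F. matching E F \<and> \<Union>F = X \<union> Y \<and> F \<inter> ?B = C}"
      if P: "P \<in> complete_pms (X - \<Union>C)" and Q: "Q \<in> complete_pms (Y - \<Union>C)" for P Q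
    proof -
      have dP: "\<And>e f. e \<in> P \<Longrightarrow> f \<in> P \<Longrightarrow> e \<noteq> f \<Longrightarrow> e \<inter> f = {}"
        and dQ: "\<And>e f. e \<in> Q \<Longrightarrow> f \<in> Q \<Longrightarrow> e \<noteq> f \<Longrightarrow> e \<inter> f = {}"
        using P Q unfolding matching_def by auto
      have UP: "\<Union>P = X - \<Union>C" and UQ: "\<Union>Q = Y - \<Union>C" using P Q by auto
      have "P \<subseteq> E" "Q \<subseteq> E"
        using P Q EX vm[of "X - \<Union>C" X] vm[of "Y - \<Union>C" Y] unfolding matching_def by auto
      hence sub: "C \<union> P \<union> Q \<subseteq> E" using CE by auto
      have cp: "e \<inter> f = {}" if "e \<in> C" "f \<in> P" for e f using that UP by blast
      have cq: "e \<inter> f = {}" if "e \<in> C" "f \<in> Q" for e f using that UQ by blast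
      have pq: "e \<inter> f = {}" if "e \<in> P" "f \<in> Q" for e f using that UP UQ X by blast
      have "matching E (C \<union> P \<union> Q)"
        unfolding matching_def using sub dC dP dQ cp cq pq by (metis Int_commute UnE)
      moreover have "\<Union>(C \<union> P \<union> Q) = X \<union> Y" using UP UQ C(2) by auto
      moreover have "(C \<union> P \<union> Q) \<inter> ?B = C"
      proof -
        have "e \<notin> ?B" if "e \<in> P \<union> Q" for e using that UP UQ BX[of e] by blast
        moreover have "C \<subseteq> ?B" using C unfolding matching_def by auto
        ultimately show ?thesis by blast
      qed
      ultimately show ?thesis by simp
    qed
    thus "(\<lambda>(P, Q). C \<union> P \<union> Q) ` (complete_pms (X - \<Union>C) \<times> complete_pms (Y - \<Union>C))
      \<subseteq> {F. matching E F \<and> \<Union>F = X \<union> Y \<and> F \<inter> ?B = C}"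
      by (intro image_subsetI) (simp only: split_beta mem_Times_iff)
    show "(\<lambda>F. (F \<inter> {e. e \<subseteq> X}, F \<inter> {e. e \<subseteq> Y})) ` {F. matching E F \<and> \<Union>F = X \<union> Y \<and> F \<inter> ?B = C}
      \<subseteq> complete_pms (X - \<Union>C) \<times> complete_pms (Y - \<Union>C)"
    proof (intro image_subsetI)
      fix F assume "F \<in> {F. matching E F \<and> \<Union>F = X \<union> Y \<and> F \<inter> ?B = C}"
      hence FE: "F \<subseteq> E" and d: "\<And>e f. e \<in> F \<Longrightarrow> f \<in> F \<Longrightarrow> e \<noteq> f \<Longrightarrow> e \<inter> f = {}"
        and U: "\<Union>F = X \<union> Y" and FC: "F \<inter> ?B = C" unfolding matching_def by auto
      \<comment> \<open>The two sides are symmetric; \<open>V\<close> is the side under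
        consideration and \<open>W\<close> the other one.\<close>
      have "F \<inter> {e. e \<subseteq> V} \<in> complete_pms (V - \<Union>C)"
        if V: "V = X \<and> W = Y \<or> V = Y \<and> W = X" for V W
      proof -
        let ?P = "F \<inter> {e. e \<subseteq> V}"
        have P: "e \<in> vpairs V" "e \<notin> ?B" if "e \<in> ?P" for e
          using that FE E V BX by auto
        have PC: "e \<inter> \<Union>C = {}" if "e \<in> ?P" for e
          using d P(2)[OF that] that FC by blast
        have c: "card e = 2" if "e \<in> ?P" for e using P[OF that] unfolding vpairs_def by auto
        have "\<Union>?P = V - \<Union>C"
        proof (intro equalityI subsetI)
          fix z assume "z \<in> \<Union>?P" thus "z \<in> V - \<Union>C" using PC by blast
        next
          fix z assume z: "z \<in> V - \<Union>C"
          then obtain e where e: "e \<in> F" "z \<in> e" using U V by blast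
          \<comment> \<open>The edge covering \<open>z\<close> cannot be a cross edge, since
            \<open>C\<close> misses \<open>z\<close>; hence it lies inside one clique, and
            \<open>z\<close> tells which.\<close>
          hence "e \<notin> ?B" using z FC by auto
          hence "e \<in> vpairs X \<or> e \<in> vpairs Y" using sp e FE by blast
          hence "e \<subseteq> V" using V z e X unfolding vpairs_def by blast
          thus "z \<in> \<Union>?P" using e by auto
        qed
        thus ?thesis using c d by (auto simp: matching_vpairs_iff)
      qed
      thus "(F \<inter> {e. e \<subseteq> X}, F \<inter> {e. e \<subseteq> Y}) \<in> complete_pms (X - \<Union>C) \<times> complete_pms (Y - \<Union>C)"
        by auto
    qed
  qed
qed

text \<open>All edges of \<open>H\<close> run between the sides, so complementation leaves both
  cliques whole. Between the sides it replaces \<open>nbhd H u\<close> by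
  \<open>Y - nbhd H u\<close>; this reverses inclusions, and neighbourhoods stay comparable.\<close>

lemma cochain_graph_structure:
  assumes "cochain_graph X Y E"
  shows "finite X" "finite Y" "X \<inter> Y = {}"
    "E \<inter> {e. e \<subseteq> X} = vpairs X" "E \<inter> {e. e \<subseteq> Y} = vpairs Y"
    "E \<subseteq> vpairs (X \<union> Y)"
    "chain_graph X Y (cross_edges X Y E)"
proof -
  obtain H where H: "chain_graph X Y H" and E: "E = complement_edges (X \<union> Y) H"
    using assms unfolding cochain_graph_def by auto
  have bip: "bipartite_graph X Y H" using H unfolding chain_graph_def by auto
  show fin: "finite X" "finite Y" and dis: "X \<inter> Y = {}"
    using bip unfolding bipartite_graph_def by auto
  have H': "\<not> e \<subseteq> X \<and> \<not> e \<subseteq> Y" if "e \<in> H" for e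
    using that bip unfolding bipartite_graph_def by blast
  show "E \<inter> {e. e \<subseteq> X} = vpairs X" "E \<inter> {e. e \<subseteq> Y} = vpairs Y"
    using H' unfolding E complement_edges_def vpairs_def by auto
  show "E \<subseteq> vpairs (X \<union> Y)" unfolding E complement_edges_def by auto
  have cross: "cross_edges X Y E = {{x, y} | x y. x \<in> X \<and> y \<in> Y} - H" (is "?B = ?K - H")
  proof (intro equalityI subsetI)
    fix e assume e: "e \<in> ?B"
    hence "e \<subseteq> X \<union> Y" "card e = 2" "e \<notin> H" "\<not> e \<subseteq> X" "\<not> e \<subseteq> Y"
      unfolding cross_edges_def E complement_edges_def vpairs_def by auto
    thus "e \<in> ?K - H" by (auto simp: card_2_iff insert_commute)
  next
    fix e assume e: "e \<in> ?K - H"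
    then obtain x y where "e = {x, y}" "x \<in> X" "y \<in> Y" by auto
    moreover have "x \<noteq> y" "x \<notin> Y" "y \<notin> X" using calculation dis by auto
    ultimately show "e \<in> ?B" using e
      unfolding cross_edges_def E complement_edges_def vpairs_def by auto
  qed
  have "nbhd ?B u = Y - nbhd H u" if "u \<in> X" for u
    using that dis unfolding cross nbhd_def by (auto simp: doubleton_eq_iff)
  moreover have "bipartite_graph X Y ?B" using fin dis cross unfolding bipartite_graph_def by auto
  ultimately show "chain_graph X Y ?B"
    using H unfolding chain_graph_def by (metis Diff_mono order_refl)
qed

lemma num_perfect_matchings_cochain:
  assumes "cochain_graph X Y E" and "card X = n" and "card Y = m"
  shows "num_perfect_matchings (X \<union> Y) E =
       (\<Sum>s = 0..min n m. num_matchings (cross_edges X Y E) s * pK (n - s) * pK (m - s))"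
proof -
  note st = cochain_graph_structure[OF assms(1)]
  let ?B = "cross_edges X Y E"
  have bip: "bipartite_graph X Y ?B" using st(7) unfolding chain_graph_def by auto
  define MB where "MB = {C. matching ?B C}"
  define PE where "PE = {F. matching E F \<and> \<Union>F = X \<union> Y}"
  have fE: "finite E" using st finite_vpairs finite_subset by (metis finite_UnI)
  have fMB: "finite MB" unfolding MB_def
    using finite_matchings[OF bipartite_graph_finite[OF bip], of "\<lambda>_. True"] by simp
  have fPE: "finite PE" unfolding PE_def by (rule finite_matchings[OF fE])
  \<comment> \<open>Every size falls into the range of summation, so the grouping by size below
    loses no matching.\<close>
  have le: "card C \<le> min n m" if "C \<in> MB" for C
    using that bipartite_matching_card_le[OF bip] bipartite_matching_card_le[OF bipartite_graph_swap[OF bip]] assms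
    unfolding MB_def by auto
  have fib: "card {F \<in> PE. F \<inter> ?B = C} = pK (n - card C) * pK (m - card C)" if "C \<in> MB" for C
  proof -
    have C: "matching ?B C" using that unfolding MB_def by auto
    have sub: "\<Union>C \<subseteq> X \<union> Y"
      using C st(6) unfolding matching_def cross_edges_def vpairs_def by blast
    have c: "card (V - \<Union>C) = card V - card C" if "V = X \<or> V = Y" for V
    proof -
      have "card (V \<inter> \<Union>C) = card C"
        using that card_matched_vertices[OF bip C] card_matched_vertices[OF bipartite_graph_swap[OF bip] C] by auto
      thus ?thesis using that st(1,2) by (metis card_Diff_subset_Int finite_Int)
    qed
    have "card {F \<in> PE. F \<inter> ?B = C} = card (complete_pms (X - \<Union>C) \<times> complete_pms (Y - \<Union>C))"
      using bij_betw_same_card[OF perfect_matchings_with_cross_edges[OF st(3,4,5) C sub]]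
      unfolding PE_def by (simp add: conj_assoc)
    also have "\<dots> = pK (n - card C) * pK (m - card C)"
      using num_perfect_matchings_complete_pK[of "X - \<Union>C"] num_perfect_matchings_complete_pK[of "Y - \<Union>C"]
        st(1,2) c assms(2,3) by (simp add: card_cartesian_product num_perfect_matchings_def)
    finally show ?thesis .
  qed
  \<comment> \<open>Two groupings: perfect matchings by their set of cross edges, then these sets by
    size. By \<open>fib\<close> the size of a class depends on \<open>C\<close> only through
    \<open>card C\<close>.\<close>
  have "card PE = (\<Sum>C\<in>MB. card {F \<in> PE. F \<inter> ?B = C})"
  proof -
    have "(\<lambda>F. F \<inter> ?B) ` PE \<subseteq> MB" unfolding PE_def MB_def matching_def by auto
    from sum.group[OF fPE fMB this, of "\<lambda>_. 1::nat"] show ?thesis by simp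
  qed
  also have "\<dots> = (\<Sum>C\<in>MB. pK (n - card C) * pK (m - card C))" using fib by simp
  also have "\<dots> = (\<Sum>s = 0..min n m. \<Sum>C\<in>{C \<in> MB. card C = s}. pK (n - card C) * pK (m - card C))"
    by (rule sum.group[symmetric]) (use fMB le in auto)
  also have "\<dots> = (\<Sum>s = 0..min n m. num_matchings ?B s * pK (n - s) * pK (m - s))"
    by (rule sum.cong) (auto simp: num_matchings_def MB_def)
  finally show ?thesis unfolding num_perfect_matchings_def PE_def .
qed

section \<open>Chain orderings and the recurrence\<close>

text \<open>Sorting by degree suffices: of two comparable finite neighbourhoods, one with at most as
  many elements as the other is contained in it. This also settles ties.\<close>

lemma chain_ordering_exists:
  assumes "chain_graph X Y B"
  shows "\<exists>x. chain_ordering X B x"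
proof -
  have bip: "bipartite_graph X Y B" using assms unfolding chain_graph_def by auto
  hence fin: "finite X" "finite Y" unfolding bipartite_graph_def by auto
  obtain ys where ys: "set ys = X" "distinct ys" using finite_distinct_list[OF fin(1)] by auto
  define xs where "xs = sort_key (degree B) ys"
  have xs: "set xs = X" "distinct xs" "sorted (map (degree B) xs)" using ys by (auto simp: xs_def)
  have len: "length xs = card X" using xs distinct_card by metis
  \<comment> \<open>Lists are indexed from 0, chain orderings from 1.\<close>
  have "bij_betw (\<lambda>i. i - 1) {1..card X} {..<card X}"
    by (rule bij_betw_byWitness[where f' = Suc]) auto
  from bij_betw_trans[OF this bij_betw_nth[OF xs(2) len[symmetric, THEN arg_cong[where f = lessThan]] xs(1)[symmetric]]]
  have bij: "bij_betw (\<lambda>i. xs ! (i - 1)) {1..card X} X" by (simp add: comp_def)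
  have "nbhd B (xs ! (i - 1)) \<subseteq> nbhd B (xs ! (j - 1))" if "1 \<le> i" "i \<le> j" "j \<le> card X" for i j
  proof -
    let ?u = "xs ! (i - 1)" and ?v = "xs ! (j - 1)"
    have "i - 1 < length xs" "j - 1 < length xs" using that len by auto
    hence uv: "?u \<in> X" "?v \<in> X" using xs(1) nth_mem by blast+
    have le: "degree B ?u \<le> degree B ?v"
      using sorted_nth_mono[OF xs(3), of "i - 1" "j - 1"] that len by simp
    have "finite (nbhd B ?u)" using bipartite_nbhd[OF bip uv(1)] fin finite_subset by auto
    thus ?thesis
      using assms uv le unfolding chain_graph_def degree_def by (metis card_seteq order_refl)
  qed
  thus ?thesis using bij unfolding chain_ordering_def by blast
qed

text \<open>Provides the hypotheses of \<open>num_matchings_dominating_vertex\<close>. The decisive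
  one is the second: since neighbourhoods grow along the ordering, the second side of the old
  subgraph may be shrunk from \<open>Y\<close> to the neighbourhood of the new vertex.\<close>

lemma induced_edges_chain_step:
  assumes bip: "bipartite_graph X Y B" and ord: "chain_ordering X B x" and i: "i < card X"
  shows "induced_edges B (x ` {1..Suc i} \<union> Y) =
      induced_edges B (x ` {1..i} \<union> Y) \<union> {{x (Suc i), y} | y. y \<in> nbhd B (x (Suc i))}" (is ?split)
    and "bipartite_graph (x ` {1..i}) (nbhd B (x (Suc i))) (induced_edges B (x ` {1..i} \<union> Y))" (is ?bip)
    and "x (Suc i) \<notin> x ` {1..i}" and "x (Suc i) \<notin> nbhd B (x (Suc i))"
proof -
  have bij: "bij_betw x {1..card X} X"
    and mono: "\<And>i j. 1 \<le> i \<Longrightarrow> i \<le> j \<Longrightarrow> j \<le> card X \<Longrightarrow> nbhd B (x i) \<subseteq> nbhd B (x j)"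
    using ord unfolding chain_ordering_def by auto
  let ?v = "x (Suc i)"
  have xX: "x j \<in> X" if "1 \<le> j" "j \<le> card X" for j using that bij unfolding bij_betw_def by auto
  have vX: "?v \<in> X" using xX i by auto
  have dis: "X \<inter> Y = {}" and fin: "finite Y" using bip unfolding bipartite_graph_def by auto
  have nY: "nbhd B ?v \<subseteq> Y" using bipartite_nbhd[OF bip vX] .
  show "?v \<notin> nbhd B ?v" using nY vX dis by auto
  show "?v \<notin> x ` {1..i}"
  proof
    assume "?v \<in> x ` {1..i}"
    then obtain j where j: "j \<in> {1..i}" "x (Suc i) = x j" by auto
    have "Suc i \<in> {1..card X}" "j \<in> {1..card X}" using i j by auto
    thus False using j bij unfolding bij_betw_def inj_on_def by fastforce
  qed
  have BE: "\<exists>u y. e = {u, y} \<and> u \<in> X \<and> y \<in> Y" if "e \<in> B" for e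
    using that bip unfolding bipartite_graph_def by blast
  show ?split
  proof (intro equalityI subsetI)
    fix e assume "e \<in> induced_edges B (x ` {1..Suc i} \<union> Y)"
    hence e: "e \<in> B" "e \<subseteq> insert ?v (x ` {1..i}) \<union> Y"
      unfolding induced_edges_def by (auto simp: atLeastAtMostSuc_conv)
    obtain u y where uy: "e = {u, y}" "u \<in> X" "y \<in> Y" using BE e by blast
    show "e \<in> induced_edges B (x ` {1..i} \<union> Y) \<union> {{?v, y} | y. y \<in> nbhd B ?v}"
    proof (cases "u = ?v")
      case True thus ?thesis using e uy unfolding nbhd_def by auto
    next
      case False
      hence "u \<in> x ` {1..i}" using e uy dis by auto
      thus ?thesis using e uy unfolding induced_edges_def by auto
    qed
  next
    fix e assume "e \<in> induced_edges B (x ` {1..i} \<union> Y) \<union> {{?v, y} | y. y \<in> nbhd B ?v}"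
    thus "e \<in> induced_edges B (x ` {1..Suc i} \<union> Y)"
      using nY unfolding induced_edges_def nbhd_def by (auto simp: atLeastAtMostSuc_conv)
  qed
  have "\<exists>u y. e = {u, y} \<and> u \<in> x ` {1..i} \<and> y \<in> nbhd B ?v"
    if "e \<in> induced_edges B (x ` {1..i} \<union> Y)" for e
  proof -
    have e: "e \<in> B" "e \<subseteq> x ` {1..i} \<union> Y" using that unfolding induced_edges_def by auto
    obtain u y where uy: "e = {u, y}" "u \<in> X" "y \<in> Y" using BE e by blast
    hence "u \<in> x ` {1..i}" using e dis by auto
    then obtain j where j: "j \<in> {1..i}" "u = x j" by auto
    have "y \<in> nbhd B (x j)" using e uy j unfolding nbhd_def by auto
    hence "y \<in> nbhd B ?v" using mono[of j "Suc i"] i j by auto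
    thus ?thesis using uy \<open>u \<in> x ` {1..i}\<close> by auto
  qed
  moreover have "x ` {1..i} \<subseteq> X" using xX i by auto
  moreover have "finite (x ` {1..i})" "finite (nbhd B ?v)" using finite_subset[OF nY fin] by auto
  ultimately show ?bip using nY dis unfolding bipartite_graph_def by blast
qed

text \<open>In this shifted form \<open>s\<close> stands for the \<open>s - 1\<close> of the
  recurrence, which absorbs the summand 1 of the factor.\<close>

lemma matching_count_Suc:
  assumes "bipartite_graph X Y B" "chain_ordering X B x" "i < card X"
  shows "int (matching_count Y B x (Suc i) (Suc s)) = int (matching_count Y B x i (Suc s))
    + (int (degree B (x (Suc i))) - int s) * int (matching_count Y B x i s)"
proof -
  note step = induced_edges_chain_step[OF assms]
  show ?thesis
    unfolding matching_count_def degree_def step(1)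
    by (rule num_matchings_dominating_vertex[OF step(2-4)])
qed

lemma induced_edges_bipartite:
  assumes "bipartite_graph X Y B" "X' \<subseteq> X"
  shows "bipartite_graph X' Y (induced_edges B (X' \<union> Y))"
proof -
  have dis: "X \<inter> Y = {}" and fin: "finite X" "finite Y" using assms(1) unfolding bipartite_graph_def by auto
  have "\<exists>u y. e = {u, y} \<and> u \<in> X' \<and> y \<in> Y" if e: "e \<in> induced_edges B (X' \<union> Y)" for e
  proof -
    have "e \<in> B" "e \<subseteq> X' \<union> Y" using e unfolding induced_edges_def by auto
    then obtain u y where "e = {u, y}" "u \<in> X" "y \<in> Y" "u \<in> X' \<union> Y"
      using assms(1) unfolding bipartite_graph_def by blast
    thus ?thesis using dis by blast
  qed
  moreover have "finite X'" using assms(2) fin(1) by (rule finite_subset)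
  ultimately show ?thesis using assms(2) dis fin(2) unfolding bipartite_graph_def by blast
qed

lemma matching_count_0:
  assumes "bipartite_graph X Y B"
  shows "matching_count Y B x i 0 = 1"
  unfolding matching_count_def
  by (rule num_matchings_0) (use bipartite_graph_finite[OF assms] in \<open>simp add: induced_edges_def\<close>)

lemma matching_count_eq_0:
  assumes "bipartite_graph X Y B" "chain_ordering X B x" "i \<le> card X" "i < s"
  shows "matching_count Y B x i s = 0"
  unfolding matching_count_def
proof (rule num_matchings_eq_0[OF induced_edges_bipartite[OF assms(1)]])
  show "x ` {1..i} \<subseteq> X" using assms(2,3) unfolding chain_ordering_def bij_betw_def by auto
  show "card (x ` {1..i}) < s \<or> card Y < s" using card_image_le[of "{1..i}" x] assms(4) by auto
qed

lemma matching_count_card: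
  assumes "bipartite_graph X Y B" "chain_ordering X B x"
  shows "matching_count Y B x (card X) s = num_matchings B s"
proof -
  have "x ` {1..card X} = X" using assms(2) unfolding chain_ordering_def bij_betw_def by auto
  moreover have "induced_edges B (X \<union> Y) = B"
    using assms(1) unfolding bipartite_graph_def induced_edges_def by auto
  ultimately show ?thesis unfolding matching_count_def by simp
qed

text \<open>In a chain graph the neighbourhood of \<open>y \<in> Y\<close> is a final segment of the ordering, hence it is
  determined by the degree of \<open>y\<close>. This recovers the ordered degree sequence of \<open>X\<close> without sorting.\<close>

lemma degree_chain_ordering:
  assumes bip: "bipartite_graph X Y B" and ord: "chain_ordering X B x" and k: "1 \<le> k" "k \<le> card X"
  shows "degree B (x k) = card {y \<in> Y. card X - k < card {u \<in> X. {u, y} \<in> B}}"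
proof -
  have bij: "bij_betw x {1..card X} X"
    and mono: "\<And>i j. 1 \<le> i \<Longrightarrow> i \<le> j \<Longrightarrow> j \<le> card X \<Longrightarrow> nbhd B (x i) \<subseteq> nbhd B (x j)"
    using ord unfolding chain_ordering_def by auto
  have xk: "x k \<in> X" using k bij unfolding bij_betw_def by auto
  have "{x k, y} \<in> B \<longleftrightarrow> card X - k < card {u \<in> X. {u, y} \<in> B}" if "y \<in> Y" for y
  proof -
    \<comment> \<open>Indices of the neighbours of \<open>y\<close>. By monotonicity
      \<open>J\<close> is a final segment of \<open>{1..card X}\<close>, so it contains
      \<open>k\<close> exactly if it has more than \<open>card X - k\<close> elements.\<close>
    define J where "J = {j \<in> {1..card X}. {x j, y} \<in> B}"
    have up: "j \<in> J" if "i \<in> J" "i \<le> j" "j \<le> card X" for i j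
      using mono[of i j] that unfolding J_def nbhd_def by auto
    have "x ` {1..card X} = X" using bij unfolding bij_betw_def by auto
    moreover have "{u \<in> x ` {1..card X}. {u, y} \<in> B} = x ` J" unfolding J_def by auto
    ultimately have "{u \<in> X. {u, y} \<in> B} = x ` J" by (simp only:)
    moreover have "inj_on x J" using bij unfolding J_def bij_betw_def by (auto intro: inj_on_subset)
    ultimately have c: "card {u \<in> X. {u, y} \<in> B} = card J" by (simp add: card_image)
    have "finite J" unfolding J_def by simp
    show ?thesis
    proof
      assume "{x k, y} \<in> B"
      hence "k \<in> J" using k unfolding J_def by auto
      hence "{k..card X} \<subseteq> J" using up by auto
      hence "card {k..card X} \<le> card J" using \<open>finite J\<close> card_mono by blast
      thus "card X - k < card {u \<in> X. {u, y} \<in> B}" using c k by simp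
    next
      assume less: "card X - k < card {u \<in> X. {u, y} \<in> B}"
      show "{x k, y} \<in> B"
      proof (rule ccontr)
        assume "{x k, y} \<notin> B"
        hence "k \<notin> J" unfolding J_def by auto
        have "J \<subseteq> {k<..card X}"
        proof
          fix j assume "j \<in> J"
          moreover from this have "\<not> j \<le> k" using up[of j k] k \<open>k \<notin> J\<close> by auto
          ultimately show "j \<in> {k<..card X}" unfolding J_def by auto
        qed
        hence "card J \<le> card X - k" using card_mono[of "{k<..card X}" J] by simp
        thus False using less c by simp
      qed
    qed
  qed
  hence "nbhd B (x k) = {y \<in> Y. card X - k < card {u \<in> X. {u, y} \<in> B}}"
    using bipartite_nbhd[OF bip xk] unfolding nbhd_def by auto
  thus ?thesis unfolding degree_def by simp
qed

section \<open>Timed execution of counting loops\<close>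

lemma runs_within_mono:
  "\<lbrakk>runs_within c \<sigma> b Q; b \<le> b'; \<And>\<tau>. Q \<tau> \<Longrightarrow> Q' \<tau>\<rbrakk> \<Longrightarrow> runs_within c \<sigma> b' Q'"
  unfolding runs_within_def by (meson order_trans)

lemma runs_within_skip: "\<lbrakk>Q \<sigma>; 1 \<le> b\<rbrakk> \<Longrightarrow> runs_within Skip \<sigma> b Q"
  unfolding runs_within_def using exec.Skip by blast

lemma runs_within_assign:
  assumes "1 + expr_cost e + expr_cost f \<le> b"
    and "Q (\<sigma>(a := (\<sigma> a)(eval_expr e \<sigma> := eval_expr f \<sigma>)))"
  shows "runs_within (Assign a e f) \<sigma> b Q"
  unfolding runs_within_def using assms exec.Assign by blast

lemma runs_within_seq:
  assumes "runs_within c \<sigma> b (\<lambda>\<tau>. runs_within d \<tau> b' Q)"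
  shows "runs_within (Seq c d) \<sigma> (b + b') Q"
proof -
  obtain t \<tau> where t: "exec c \<sigma> t \<tau>" "t \<le> b" "runs_within d \<tau> b' Q"
    using assms unfolding runs_within_def by blast
  then obtain u \<rho> where u: "exec d \<tau> u \<rho>" "u \<le> b'" "Q \<rho>" unfolding runs_within_def by blast
  show ?thesis unfolding runs_within_def using exec.Seq[OF t(1) u(1)] t(2) u(2,3) by (meson add_mono)
qed

lemma runs_within_if:
  assumes "eval_expr e \<sigma> < eval_expr f \<sigma> \<Longrightarrow> runs_within c \<sigma> b Q"
    and "\<not> eval_expr e \<sigma> < eval_expr f \<sigma> \<Longrightarrow> runs_within d \<sigma> b Q"
  shows "runs_within (IfLess e f c d) \<sigma> (1 + expr_cost e + expr_cost f + b) Q"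
proof (cases "eval_expr e \<sigma> < eval_expr f \<sigma>")
  case True
  with assms(1) obtain t \<tau> where "exec c \<sigma> t \<tau>" "t \<le> b" "Q \<tau>" unfolding runs_within_def by blast
  thus ?thesis unfolding runs_within_def using exec.IfTrue[OF True] by (meson add_left_mono)
next
  case False
  with assms(2) obtain t \<tau> where "exec d \<sigma> t \<tau>" "t \<le> b" "Q \<tau>" unfolding runs_within_def by blast
  thus ?thesis unfolding runs_within_def using exec.IfFalse[OF False] by (meson add_left_mono)
qed

lemma runs_within_while_step:
  assumes "eval_expr e \<sigma> < eval_expr f \<sigma>"
    and "runs_within c \<sigma> b (\<lambda>\<tau>. runs_within (WhileLess e f c) \<tau> b' Q)"
  shows "runs_within (WhileLess e f c) \<sigma> (1 + expr_cost e + expr_cost f + b + b') Q"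
proof -
  obtain t \<tau> where t: "exec c \<sigma> t \<tau>" "t \<le> b" "runs_within (WhileLess e f c) \<tau> b' Q"
    using assms unfolding runs_within_def by blast
  then obtain u \<rho> where u: "exec (WhileLess e f c) \<tau> u \<rho>" "u \<le> b'" "Q \<rho>"
    unfolding runs_within_def by blast
  show ?thesis unfolding runs_within_def
    using exec.WhileTrue[OF assms(1) t(1) u(1)] t(2) u(2,3) by (meson add_mono order_refl)
qed

abbreviation Var :: "string \<Rightarrow> expr" where
  "Var a \<equiv> Cell a (Const 0)"

text \<open>The limit \<open>e\<close> is evaluated again at every test; the loop rule therefore
  asks that the invariant determine its value.\<close>

definition For :: "string \<Rightarrow> expr \<Rightarrow> com \<Rightarrow> com" where
  "For v e c = Seq (Assign v (Const 0) (Const 0))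
     (WhileLess (Var v) e (Seq c (Assign v (Const 0) (Plus (Var v) (Const 1)))))"

text \<open>Initialisation costs 3 and the last test \<open>3 + expr_cost e\<close>. A round
  consists of a test of that cost, the body, and an increment of cost 6. The body has to preserve
  the counter, and the invariant for \<open>Suc i\<close> is required only of the store after the
  increment.\<close>

lemma runs_within_for:
  assumes init: "I 0 (\<sigma>(v := (\<sigma> v)(0 := 0)))"
    and body: "\<And>i \<tau>. \<lbrakk>i < N; I i \<tau>; \<tau> v 0 = int i\<rbrakk> \<Longrightarrow> runs_within c \<tau> b
      (\<lambda>\<tau>'. \<tau>' v 0 = int i \<and> I (Suc i) (\<tau>'(v := (\<tau>' v)(0 := int i + 1))))"
    and bound: "\<And>i \<tau>. I i \<tau> \<Longrightarrow> eval_expr e \<tau> = int N"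
  shows "runs_within (For v e c) \<sigma> (6 + expr_cost e + N * (9 + expr_cost e + b)) (I N)"
proof -
  let ?W = "WhileLess (Var v) e (Seq c (Assign v (Const 0) (Plus (Var v) (Const 1))))"
  let ?k = "9 + expr_cost e + b"
  have loop: "runs_within ?W \<tau> (3 + expr_cost e + (N - i) * ?k) (I N)"
    if "i \<le> N" "I i \<tau>" "\<tau> v 0 = int i" for i \<tau>
    using that
  proof (induction "N - i" arbitrary: i \<tau>)
    case 0
    hence "i = N" by simp
    hence "exec ?W \<tau> (1 + expr_cost (Var v) + expr_cost e) \<tau>"
      using 0 bound by (intro exec.WhileFalse) auto
    moreover have "1 + expr_cost (Var v) + expr_cost e \<le> 3 + expr_cost e + (N - i) * ?k" by simp
    ultimately show ?case using \<open>i = N\<close> 0 unfolding runs_within_def by blast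
  next
    case (Suc r)
    hence i: "i < N" by simp
    have "runs_within (Seq c (Assign v (Const 0) (Plus (Var v) (Const 1)))) \<tau> (b + 6)
      (\<lambda>\<tau>. runs_within ?W \<tau> (3 + expr_cost e + (N - Suc i) * ?k) (I N))"
    proof (rule runs_within_seq, rule runs_within_mono[OF body[OF i Suc.prems(2,3)] order_refl], rule runs_within_assign)
      fix \<rho> assume \<rho>: "\<rho> v 0 = int i \<and> I (Suc i) (\<rho>(v := (\<rho> v)(0 := int i + 1)))"
      show "runs_within ?W (\<rho>(v := (\<rho> v)(eval_expr (Const 0) \<rho> := eval_expr (Plus (Var v) (Const 1)) \<rho>)))
        (3 + expr_cost e + (N - Suc i) * ?k) (I N)"
        by (rule Suc.hyps(1)) (use \<rho> Suc.hyps(2) i in auto)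
    qed simp
    moreover have "eval_expr (Var v) \<tau> < eval_expr e \<tau>" using i Suc.prems bound by simp
    ultimately have "runs_within ?W \<tau>
      (1 + expr_cost (Var v) + expr_cost e + (b + 6) + (3 + expr_cost e + (N - Suc i) * ?k)) (I N)"
      using runs_within_while_step by blast
    moreover have "(N - i) * ?k = ?k + (N - Suc i) * ?k" using i by (simp add: Suc_diff_Suc[symmetric])
    ultimately show ?case by (elim runs_within_mono) auto
  qed
  have "runs_within (For v e c) \<sigma> (3 + (3 + expr_cost e + (N - 0) * ?k)) (I N)"
    unfolding For_def
    by (rule runs_within_seq, rule runs_within_assign) (use loop[of 0] init in auto)
  thus ?thesis by (simp add: add.assoc)
qed

definition unchanged_except :: "string set \<Rightarrow> store \<Rightarrow> store \<Rightarrow> bool" where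
  "unchanged_except S \<sigma> \<tau> \<longleftrightarrow> (\<forall>a. a \<notin> S \<longrightarrow> \<tau> a = \<sigma> a)"

lemma unchanged_except_refl: "unchanged_except S \<sigma> \<sigma>"
  unfolding unchanged_except_def by simp

lemma unchanged_except_upd: "a \<in> S \<Longrightarrow> unchanged_except S \<sigma> (\<tau>(a := g)) \<longleftrightarrow> unchanged_except S \<sigma> \<tau>"
  unfolding unchanged_except_def by auto

lemma unchanged_exceptD: "unchanged_except S \<sigma> \<tau> \<Longrightarrow> a \<notin> S \<Longrightarrow> \<tau> a = \<sigma> a"
  unfolding unchanged_except_def by simp

section \<open>Computing the table and the final sum\<close>

definition table_cell :: "nat \<Rightarrow> nat \<Rightarrow> nat \<Rightarrow> int" where
  "table_cell n i s = int i * (int n + 1) + int s"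

text \<open>Uniqueness of quotient and remainder modulo \<open>n + 1\<close>. It ensures that
  writing one entry of the table destroys no other.\<close>

lemma table_cell_eq_iff:
  assumes "s \<le> n" "s' \<le> n"
  shows "table_cell n i s = table_cell n i' s' \<longleftrightarrow> i = i' \<and> s = s'"
proof
  assume "table_cell n i s = table_cell n i' s'"
  hence "int (s + i * Suc n) = int (s' + i' * Suc n)" unfolding table_cell_def by (simp add: algebra_simps)
  hence *: "s + i * Suc n = s' + i' * Suc n" by (simp only: of_nat_eq_iff)
  have "(s + i * Suc n) div Suc n = i" "(s' + i' * Suc n) div Suc n = i'"
    using assms by (simp_all only: div_mult_self1[OF Suc_not_Zero] div_less less_Suc_eq_le add_0_right)
  with * have "i = i'" by simp
  thus "i = i' \<and> s = s'" using * by simp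
qed simp

text \<open>The inner loop fills the whole row: for \<open>s > i\<close> the recurrence yields \<open>0\<close> as well.\<close>

definition table_program :: com where
  "table_program =
    Seq (Assign ''M'' (Const 0) (Const 1))
    (For ''i'' (Var ''n'')
      (Seq (Assign ''M'' (Times (Plus (Var ''i'') (Const 1)) (Plus (Var ''n'') (Const 1))) (Const 1))
      (For ''s'' (Var ''n'')
        (Assign ''M''
          (Plus (Times (Plus (Var ''i'') (Const 1)) (Plus (Var ''n'') (Const 1))) (Plus (Var ''s'') (Const 1)))
          (Plus (Cell ''M'' (Plus (Times (Var ''i'') (Plus (Var ''n'') (Const 1))) (Plus (Var ''s'') (Const 1))))
             (Times (Minus (Cell ''deg'' (Plus (Var ''i'') (Const 1))) (Var ''s''))
                (Cell ''M'' (Plus (Times (Var ''i'') (Plus (Var ''n'') (Const 1))) (Var ''s'')))))))))"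

text \<open>Formulated for any integer solution \<open>f\<close> of the recurrence, so that no graph
  appears in the execution argument.\<close>

lemma table_program_correct:
  fixes f :: "nat \<Rightarrow> nat \<Rightarrow> int"
  assumes n: "\<sigma> ''n'' 0 = int n" and deg: "\<And>i. i < n \<Longrightarrow> \<sigma> ''deg'' (int (Suc i)) = d (Suc i)"
    and M: "\<And>k. \<sigma> ''M'' k = 0"
    and f0: "\<And>i. i \<le> n \<Longrightarrow> f i 0 = 1" and f0s: "\<And>s. f 0 (Suc s) = 0"
    and fS: "\<And>i s. i < n \<Longrightarrow> f (Suc i) (Suc s) = f i (Suc s) + (d (Suc i) - int s) * f i s"
  shows "runs_within table_program \<sigma> (100 * (n + 1)\<^sup>2)
    (\<lambda>\<tau>. (\<forall>i\<le>n. \<forall>s\<le>n. \<tau> ''M'' (table_cell n i s) = f i s) \<and> unchanged_except {''M'', ''i'', ''s''} \<sigma> \<tau>)"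
proof -
  let ?S = "{''M'', ''i'', ''s''}"
  define I where "I = (\<lambda>i \<tau>. (\<forall>i'\<le>i. \<forall>s\<le>n. \<tau> ''M'' (table_cell n i' s) = f i' s) \<and> unchanged_except ?S \<sigma> \<tau>)"
  \<comment> \<open>Row \<open>Suc i\<close> is filled up to column \<open>s\<close>. The outer
    counter is part of the invariant because the body of the outer loop must return it
    unchanged.\<close>
  define J where "J = (\<lambda>i s \<tau>. I i \<tau> \<and> \<tau> ''i'' 0 = int i \<and>
    (\<forall>s'\<le>s. \<tau> ''M'' (table_cell n (Suc i) s') = f (Suc i) s'))"
  have frame: "\<tau> ''n'' = \<sigma> ''n''" "\<tau> ''deg'' = \<sigma> ''deg''" if "I i \<tau>" for i \<tau>
    using that unchanged_exceptD[of ?S \<sigma> \<tau>] unfolding I_def by auto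
  let ?row = "Times (Plus (Var ''i'') (Const 1)) (Plus (Var ''n'') (Const 1))"
  let ?idx = "Plus ?row (Plus (Var ''s'') (Const 1))"
  let ?val = "Plus (Cell ''M'' (Plus (Times (Var ''i'') (Plus (Var ''n'') (Const 1))) (Plus (Var ''s'') (Const 1))))
             (Times (Minus (Cell ''deg'' (Plus (Var ''i'') (Const 1))) (Var ''s''))
                (Cell ''M'' (Plus (Times (Var ''i'') (Plus (Var ''n'') (Const 1))) (Var ''s''))))"
  \<comment> \<open>The assignment costs 49; with 11 for test and increment, a round of the inner
    loop costs 60.\<close>
  have cell: "runs_within (Assign ''M'' ?idx ?val) \<tau> 49
      (\<lambda>\<tau>'. \<tau>' ''s'' 0 = int s \<and> J i (Suc s) (\<tau>'(''s'' := (\<tau>' ''s'')(0 := int s + 1))))"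
    if i: "i < n" and s: "s < n" and J: "J i s \<tau>" "\<tau> ''s'' 0 = int s" for i s \<tau>
  proof (rule runs_within_assign)
    have I: "I i \<tau>" and ti: "\<tau> ''i'' 0 = int i" using J(1) unfolding J_def by auto
    have idx: "eval_expr ?idx \<tau> = table_cell n (Suc i) (Suc s)"
      using ti J(2) frame[OF I] n unfolding table_cell_def by (simp add: algebra_simps)
    have c1: "int i * (int n + 1) + (int s + 1) = table_cell n i (Suc s)"
      and c2: "int i * (int n + 1) + int s = table_cell n i s"
      and c3: "\<sigma> ''deg'' (int i + 1) = d (Suc i)"
      using deg[OF i] unfolding table_cell_def by (simp_all add: algebra_simps)
    have "\<tau> ''M'' (table_cell n i (Suc s)) = f i (Suc s)" "\<tau> ''M'' (table_cell n i s) = f i s"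
      using I s unfolding I_def by auto
    hence val: "eval_expr ?val \<tau> = f (Suc i) (Suc s)"
      using ti J(2) frame[OF I] n fS[OF i, of s] by (simp add: c1 c2 c3)
    show "(\<lambda>\<tau>'. \<tau>' ''s'' 0 = int s \<and> J i (Suc s) (\<tau>'(''s'' := (\<tau>' ''s'')(0 := int s + 1))))
      (\<tau>(''M'' := (\<tau> ''M'')(eval_expr ?idx \<tau> := eval_expr ?val \<tau>)))"
      unfolding idx val using J s
      by (auto simp: J_def I_def unchanged_except_upd table_cell_eq_iff le_Suc_eq)
  qed simp
  have row: "runs_within (Seq (Assign ''M'' ?row (Const 1)) (For ''s'' (Var ''n'') (Assign ''M'' ?idx ?val))) \<tau>
      (11 + (8 + n * 60)) (\<lambda>\<tau>'. \<tau>' ''i'' 0 = int i \<and> I (Suc i) (\<tau>'(''i'' := (\<tau>' ''i'')(0 := int i + 1))))"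
    if i: "i < n" and I: "I i \<tau>" "\<tau> ''i'' 0 = int i" for i \<tau>
  proof (rule runs_within_seq, rule runs_within_assign)
    have idx: "eval_expr ?row \<tau> = table_cell n (Suc i) 0"
      using I frame[OF I(1)] n unfolding table_cell_def by (simp add: algebra_simps)
    let ?\<tau>' = "\<tau>(''M'' := (\<tau> ''M'')(eval_expr ?row \<tau> := eval_expr (Const 1) \<tau>))"
    have init: "J i 0 (?\<tau>'(''s'' := (?\<tau>' ''s'')(0 := 0)))"
      unfolding idx using I f0[of "Suc i"] i
      by (auto simp: J_def I_def unchanged_except_upd table_cell_eq_iff)
    have bound: "eval_expr (Var ''n'') \<rho> = int n" if "J i s \<rho>" for s \<rho>
      using that frame[of i \<rho>] n by (simp add: J_def)
    have "runs_within (For ''s'' (Var ''n'') (Assign ''M'' ?idx ?val)) ?\<tau>' (8 + n * 60) (J i n)"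
      by (rule runs_within_mono[OF runs_within_for[of "J i" ?\<tau>' "''s''" n, OF init cell[OF i] bound]]) auto
    thus "runs_within (For ''s'' (Var ''n'') (Assign ''M'' ?idx ?val)) ?\<tau>' (8 + n * 60)
      (\<lambda>\<tau>'. \<tau>' ''i'' 0 = int i \<and> I (Suc i) (\<tau>'(''i'' := (\<tau>' ''i'')(0 := int i + 1))))"
      by (rule runs_within_mono) (auto simp: J_def I_def unchanged_except_upd le_Suc_eq)
  qed simp
  \<comment> \<open>The bound equals \<open>60 * n^2 + 30 * n + 11\<close>; the factor 100 is a
    rounded value above it.\<close>
  have "runs_within table_program \<sigma> (3 + (8 + n * (11 + (11 + (8 + n * 60))))) (I n)"
    unfolding table_program_def
  proof (rule runs_within_seq, rule runs_within_assign)
    let ?\<tau>' = "\<sigma>(''M'' := (\<sigma> ''M'')(eval_expr (Const 0) \<sigma> := eval_expr (Const 1) \<sigma>))"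
    \<comment> \<open>Only the first cell of row 0 is ever written; its other zeros are those of the
      initial array.\<close>
    have "f 0 s = (if s = 0 then 1 else 0)" for s using f0 f0s by (cases s) auto
    hence init: "I 0 (?\<tau>'(''i'' := (?\<tau>' ''i'')(0 := 0)))"
      using M by (auto simp: I_def unchanged_except_upd unchanged_except_refl table_cell_def)
    have bound: "eval_expr (Var ''n'') \<rho> = int n" if "I i \<rho>" for i \<rho>
      using that frame n by simp
    show "runs_within (For ''i'' (Var ''n'')
      (Seq (Assign ''M'' ?row (Const 1)) (For ''s'' (Var ''n'') (Assign ''M'' ?idx ?val)))) ?\<tau>'
      (8 + n * (11 + (11 + (8 + n * 60)))) (I n)"
      by (rule runs_within_mono[OF runs_within_for[of I ?\<tau>' "''i''" n, OF init row bound]]) auto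
  qed simp
  thus ?thesis
    by (rule runs_within_mono) (auto simp: I_def power2_eq_square algebra_simps)
qed

text \<open>The sum runs up to \<open>n\<close> instead of \<open>min n m\<close>. For \<open>s > m\<close> the array \<open>pK\<close> is read at a negative
  index, which is harmless because there is no matching of size \<open>s\<close>.\<close>

definition sum_program :: com where
  "sum_program =
    For ''s'' (Plus (Var ''n'') (Const 1))
      (Assign ''p'' (Const 0) (Plus (Var ''p'')
        (Times (Times (Cell ''M'' (Plus (Times (Var ''n'') (Plus (Var ''n'') (Const 1))) (Var ''s'')))
          (Cell ''pK'' (Minus (Var ''n'') (Var ''s'')))) (Cell ''pK'' (Minus (Var ''m'') (Var ''s''))))))"

lemma sum_program_correct:
  assumes n: "\<sigma> ''n'' 0 = int n" and m: "\<sigma> ''m'' 0 = int m" and p: "\<sigma> ''p'' 0 = 0"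
    and M: "\<And>s. s \<le> n \<Longrightarrow> \<sigma> ''M'' (table_cell n n s) = g s"
    and pK: "\<And>t. t \<le> max n m \<Longrightarrow> \<sigma> ''pK'' (int t) = int (pK t)"
    and g0: "\<And>s. m < s \<Longrightarrow> g s = 0"
  shows "runs_within sum_program \<sigma> (60 * (n + 1))
    (\<lambda>\<tau>. \<tau> ''p'' 0 = (\<Sum>s = 0..min n m. g s * int (pK (n - s)) * int (pK (m - s))))"
proof -
  let ?h = "\<lambda>s. g s * int (pK (n - s)) * int (pK (m - s))"
  \<comment> \<open>The upper limit of the sum is the loop counter; the summation index shadows
    it.\<close>
  define I where "I = (\<lambda>s \<tau>. \<tau> ''p'' 0 = (\<Sum>s<s. ?h s) \<and> unchanged_except {''p'', ''s''} \<sigma> \<tau>)"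
  have frame: "\<tau> ''n'' = \<sigma> ''n''" "\<tau> ''m'' = \<sigma> ''m''" "\<tau> ''pK'' = \<sigma> ''pK''" "\<tau> ''M'' = \<sigma> ''M''"
    if "I i \<tau>" for i \<tau>
    using that unchanged_exceptD[of "{''p'', ''s''}" \<sigma> \<tau>] unfolding I_def by auto
  have "runs_within sum_program \<sigma> (6 + 4 + Suc n * (9 + 4 + 30)) (I (Suc n))"
    unfolding sum_program_def
  proof (rule runs_within_mono[OF runs_within_for[of I, where N = "Suc n"]])
    fix s \<tau> assume s: "s < Suc n" and I: "I s \<tau>" and ts: "\<tau> ''s'' 0 = int s"
    have c: "int n * (int n + 1) + int s = table_cell n n s" unfolding table_cell_def ..
    have h: "g s * \<sigma> ''pK'' (int n - int s) * \<sigma> ''pK'' (int m - int s) = ?h s"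
    proof (cases "s \<le> m")
      case True
      have "\<sigma> ''pK'' (int n - int s) = int (pK (n - s))" "\<sigma> ''pK'' (int m - int s) = int (pK (m - s))"
        using pK[of "n - s"] pK[of "m - s"] s True by (simp_all add: of_nat_diff)
      thus ?thesis by (simp only:)
    qed (use g0 in simp)
    let ?val = "Plus (Var ''p'')
        (Times (Times (Cell ''M'' (Plus (Times (Var ''n'') (Plus (Var ''n'') (Const 1))) (Var ''s'')))
          (Cell ''pK'' (Minus (Var ''n'') (Var ''s'')))) (Cell ''pK'' (Minus (Var ''m'') (Var ''s''))))"
    have "eval_expr ?val \<tau> =
        \<tau> ''p'' 0 + \<sigma> ''M'' (table_cell n n s) * \<sigma> ''pK'' (int n - int s) * \<sigma> ''pK'' (int m - int s)"
      by (simp add: c ts n m frame[OF I])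
    also have "\<dots> = (\<Sum>s<Suc s. ?h s)"
      using I M[of s] s h unfolding I_def by (simp only: less_Suc_eq_le sum.lessThan_Suc)
    finally have val: "eval_expr ?val \<tau> = (\<Sum>s<Suc s. ?h s)" .
    show "runs_within (Assign ''p'' (Const 0) ?val) \<tau> 30
      (\<lambda>\<tau>'. \<tau>' ''s'' 0 = int s \<and> I (Suc s) (\<tau>'(''s'' := (\<tau>' ''s'')(0 := int s + 1))))"
    proof (rule runs_within_assign)
      show "(\<lambda>\<tau>'. \<tau>' ''s'' 0 = int s \<and> I (Suc s) (\<tau>'(''s'' := (\<tau>' ''s'')(0 := int s + 1))))
        (\<tau>(''p'' := (\<tau> ''p'')(eval_expr (Const 0) \<tau> := eval_expr ?val \<tau>)))"
        unfolding val using I ts by (simp add: I_def unchanged_except_upd)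
    qed simp
  next
    fix s \<tau> assume "I s \<tau>"
    thus "eval_expr (Plus (Var ''n'') (Const 1)) \<tau> = int (Suc n)" using frame n by simp
  qed (use p in \<open>auto simp: I_def unchanged_except_upd unchanged_except_refl\<close>)
  moreover have "(\<Sum>s<Suc n. ?h s) = (\<Sum>s = 0..min n m. ?h s)"
    by (rule sum.mono_neutral_right) (use g0 in auto)
  ultimately show ?thesis by (elim runs_within_mono) (auto simp: I_def)
qed

section \<open>Ordered degrees from the adjacency matrix\<close>

text \<open>The first \<open>n\<close> entries of column \<open>n + j\<close> belong to pairs of a
  vertex of \<open>X\<close> and the vertex \<open>n + j\<close> of \<open>Y\<close>; their sum is
  the degree of this vertex in the bipartite part.\<close>

definition column_degree_program :: com where
  "column_degree_program =
    For ''j'' (Var ''m'') (For ''i'' (Var ''n'')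
      (Assign ''b'' (Var ''j'') (Plus (Cell ''b'' (Var ''j''))
        (Cell ''adj'' (Plus (Times (Var ''i'') (Plus (Var ''n'') (Var ''m''))) (Plus (Var ''n'') (Var ''j'')))))))"

lemma card_Collect_Suc:
  "card {i. i < Suc k \<and> P i} = card {i. i < k \<and> P i} + (if P k then 1 else 0)"
proof -
  have "{i. i < Suc k \<and> P i} = {i. i < k \<and> P i} \<union> (if P k then {k} else {})"
    by (auto simp: less_Suc_eq)
  thus ?thesis by (simp add: card_insert_if)
qed

lemma column_degree_program_correct:
  assumes n: "\<sigma> ''n'' 0 = int n" and m: "\<sigma> ''m'' 0 = int m" and b: "\<And>k. \<sigma> ''b'' k = 0"
    and adj: "\<And>i j. \<lbrakk>i < n; j < m\<rbrakk> \<Longrightarrow>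
      \<sigma> ''adj'' (int i * (int n + int m) + (int n + int j)) = (if P i j then 1 else 0)"
  shows "runs_within column_degree_program \<sigma> (8 + m * (19 + n * 50))
    (\<lambda>\<tau>. (\<forall>j<m. \<tau> ''b'' (int j) = int (card {i. i < n \<and> P i j})) \<and> unchanged_except {''b'', ''i'', ''j''} \<sigma> \<tau>)"
proof -
  let ?S = "{''b'', ''i'', ''j''}"
  \<comment> \<open>\<open>I\<close> leaves cell \<open>j\<close> open because it accumulates during
    the inner loop: \<open>J\<close> gives its partial sum, and \<open>I'\<close> adds that it is
    still 0 before that loop.\<close>
  define I where "I = (\<lambda>j \<tau>. (\<forall>j'<j. \<tau> ''b'' (int j') = int (card {i. i < n \<and> P i j'})) \<and>
    (\<forall>j'>j. \<tau> ''b'' (int j') = 0) \<and> unchanged_except ?S \<sigma> \<tau>)"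
  define J where "J = (\<lambda>j i \<tau>. I j \<tau> \<and> \<tau> ''j'' 0 = int j \<and> \<tau> ''b'' (int j) = int (card {u. u < i \<and> P u j}))"
  define I' where "I' = (\<lambda>j \<tau>. I j \<tau> \<and> \<tau> ''b'' (int j) = 0)"
  have frame: "\<tau> ''n'' = \<sigma> ''n''" "\<tau> ''m'' = \<sigma> ''m''" "\<tau> ''adj'' = \<sigma> ''adj''" if "I i \<tau>" for i \<tau>
    using that unchanged_exceptD[of ?S \<sigma> \<tau>] unfolding I_def by auto
  let ?c = "Assign ''b'' (Var ''j'') (Plus (Cell ''b'' (Var ''j''))
        (Cell ''adj'' (Plus (Times (Var ''i'') (Plus (Var ''n'') (Var ''m''))) (Plus (Var ''n'') (Var ''j'')))))"
  \<comment> \<open>The value 39 is generous: with 11 for test and increment it makes 50 per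
    round.\<close>
  have cell: "runs_within ?c \<tau> 39
      (\<lambda>\<tau>'. \<tau>' ''i'' 0 = int i \<and> J j (Suc i) (\<tau>'(''i'' := (\<tau>' ''i'')(0 := int i + 1))))"
    if j: "j < m" and i: "i < n" and J: "J j i \<tau>" "\<tau> ''i'' 0 = int i" for i j \<tau>
  proof -
    have I: "I j \<tau>" using J unfolding J_def by auto
    show ?thesis using J n m frame[OF I] adj[OF i j]
      by (intro runs_within_assign) (auto simp: J_def I_def unchanged_except_upd card_Collect_Suc)
  qed
  have row: "runs_within (For ''i'' (Var ''n'') ?c) \<tau> (8 + n * 50)
      (\<lambda>\<tau>'. \<tau>' ''j'' 0 = int j \<and> I' (Suc j) (\<tau>'(''j'' := (\<tau>' ''j'')(0 := int j + 1))))"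
    if j: "j < m" and I: "I' j \<tau>" "\<tau> ''j'' 0 = int j" for j \<tau>
  proof -
    have init: "J j 0 (\<tau>(''i'' := (\<tau> ''i'')(0 := 0)))"
      using I by (auto simp: J_def I'_def I_def unchanged_except_upd)
    have bound: "eval_expr (Var ''n'') \<rho> = int n" if "J j k \<rho>" for k \<rho>
      using that frame[of j \<rho>] n by (simp add: J_def)
    have "runs_within (For ''i'' (Var ''n'') ?c) \<tau> (8 + n * 50) (J j n)"
      by (rule runs_within_mono[OF runs_within_for[of "J j" \<tau> "''i''" n, OF init cell[OF j] bound]]) auto
    thus ?thesis
      by (rule runs_within_mono) (auto simp: J_def I'_def I_def unchanged_except_upd less_Suc_eq)
  qed
  have init: "I' 0 (\<sigma>(''j'' := (\<sigma> ''j'')(0 := 0)))"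
    using b by (auto simp: I'_def I_def unchanged_except_upd unchanged_except_refl)
  have bound: "eval_expr (Var ''m'') \<rho> = int m" if "I' k \<rho>" for k \<rho>
    using that frame[of k \<rho>] m by (simp add: I'_def)
  have "runs_within column_degree_program \<sigma> (8 + m * (19 + n * 50)) (I' m)"
    unfolding column_degree_program_def
    by (rule runs_within_mono[OF runs_within_for[of I' \<sigma> "''j''" m, OF init row bound]]) auto
  thus ?thesis by (rule runs_within_mono) (auto simp: I'_def I_def)
qed

text \<open>Evaluates the formula of \<open>degree_chain_ordering\<close> at
  \<open>k = i + 1\<close>, with one comparison for each vertex of \<open>Y\<close>.\<close>

definition row_degree_program :: com where
  "row_degree_program =
    For ''i'' (Var ''n'') (For ''j'' (Var ''m'')
      (IfLess (Minus (Var ''n'') (Plus (Var ''i'') (Const 1))) (Cell ''b'' (Var ''j''))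
        (Assign ''deg'' (Plus (Var ''i'') (Const 1)) (Plus (Cell ''deg'' (Plus (Var ''i'') (Const 1))) (Const 1)))
        Skip))"

lemma row_degree_program_correct:
  assumes n: "\<sigma> ''n'' 0 = int n" and m: "\<sigma> ''m'' 0 = int m" and deg: "\<And>k. \<sigma> ''deg'' k = 0"
    and b: "\<And>j. j < m \<Longrightarrow> \<sigma> ''b'' (int j) = int (\<beta> j)"
  shows "runs_within row_degree_program \<sigma> (8 + n * (19 + m * 50))
    (\<lambda>\<tau>. (\<forall>i<n. \<tau> ''deg'' (int (Suc i)) = int (card {j. j < m \<and> n - Suc i < \<beta> j})) \<and>
       unchanged_except {''deg'', ''i'', ''j''} \<sigma> \<tau>)"
proof -
  let ?S = "{''deg'', ''i'', ''j''}"
  define I where "I = (\<lambda>i \<tau>. (\<forall>i'<i. \<tau> ''deg'' (int (Suc i')) = int (card {j. j < m \<and> n - Suc i' < \<beta> j})) \<and>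
    (\<forall>i'>i. \<tau> ''deg'' (int (Suc i')) = 0) \<and> unchanged_except ?S \<sigma> \<tau>)"
  define J where "J = (\<lambda>i j \<tau>. I i \<tau> \<and> \<tau> ''i'' 0 = int i \<and>
    \<tau> ''deg'' (int (Suc i)) = int (card {u. u < j \<and> n - Suc i < \<beta> u}))"
  define I' where "I' = (\<lambda>i \<tau>. I i \<tau> \<and> \<tau> ''deg'' (int (Suc i)) = 0)"
  have frame: "\<tau> ''n'' = \<sigma> ''n''" "\<tau> ''m'' = \<sigma> ''m''" "\<tau> ''b'' = \<sigma> ''b''" if "I i \<tau>" for i \<tau>
    using that unchanged_exceptD[of ?S \<sigma> \<tau>] unfolding I_def by auto
  let ?e = "Minus (Var ''n'') (Plus (Var ''i'') (Const 1))" and ?f = "Cell ''b'' (Var ''j'')"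
  let ?a = "Assign ''deg'' (Plus (Var ''i'') (Const 1)) (Plus (Cell ''deg'' (Plus (Var ''i'') (Const 1))) (Const 1))"
  have cell: "runs_within (IfLess ?e ?f ?a Skip) \<tau> 39
      (\<lambda>\<tau>'. \<tau>' ''j'' 0 = int j \<and> J i (Suc j) (\<tau>'(''j'' := (\<tau>' ''j'')(0 := int j + 1))))"
      (is "runs_within _ _ _ ?Q")
    if i: "i < n" and j: "j < m" and J: "J i j \<tau>" "\<tau> ''j'' 0 = int j" for i j \<tau>
  proof -
    have I: "I i \<tau>" using J unfolding J_def by auto
    \<comment> \<open>Since \<open>i < n\<close>, the integer subtraction of the program agrees with
      the truncated one of the natural numbers.\<close>
    have cond: "eval_expr ?e \<tau> < eval_expr ?f \<tau> \<longleftrightarrow> n - Suc i < \<beta> j"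
      using J n m frame[OF I] b[OF j] i by (auto simp: J_def)
    have "runs_within (IfLess ?e ?f ?a Skip) \<tau> (1 + expr_cost ?e + expr_cost ?f + 20) ?Q"
    proof (rule runs_within_if)
      assume "eval_expr ?e \<tau> < eval_expr ?f \<tau>"
      hence "n - Suc i < \<beta> j" using cond by blast
      thus "runs_within ?a \<tau> 20 ?Q" using J
        by (intro runs_within_assign) (auto simp: J_def I_def unchanged_except_upd card_Collect_Suc add.commute)
    next
      assume "\<not> eval_expr ?e \<tau> < eval_expr ?f \<tau>"
      hence "\<not> n - Suc i < \<beta> j" using cond by blast
      thus "runs_within Skip \<tau> 20 ?Q" using J
        by (intro runs_within_skip) (auto simp: J_def I_def unchanged_except_upd card_Collect_Suc)
    qed
    thus ?thesis by (rule runs_within_mono) auto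
  qed
  have row: "runs_within (For ''j'' (Var ''m'') (IfLess ?e ?f ?a Skip)) \<tau> (8 + m * 50)
      (\<lambda>\<tau>'. \<tau>' ''i'' 0 = int i \<and> I' (Suc i) (\<tau>'(''i'' := (\<tau>' ''i'')(0 := int i + 1))))"
    if i: "i < n" and I: "I' i \<tau>" "\<tau> ''i'' 0 = int i" for i \<tau>
  proof -
    have init: "J i 0 (\<tau>(''j'' := (\<tau> ''j'')(0 := 0)))"
      using I by (auto simp: J_def I'_def I_def unchanged_except_upd)
    have bound: "eval_expr (Var ''m'') \<rho> = int m" if "J i k \<rho>" for k \<rho>
      using that frame[of i \<rho>] m by (simp add: J_def)
    have "runs_within (For ''j'' (Var ''m'') (IfLess ?e ?f ?a Skip)) \<tau> (8 + m * 50) (J i m)"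
      by (rule runs_within_mono[OF runs_within_for[of "J i" \<tau> "''j''" m, OF init cell[OF i] bound]]) auto
    thus ?thesis
      by (rule runs_within_mono) (auto simp: J_def I'_def I_def unchanged_except_upd less_Suc_eq)
  qed
  have init: "I' 0 (\<sigma>(''i'' := (\<sigma> ''i'')(0 := 0)))"
    using deg by (auto simp: I'_def I_def unchanged_except_upd unchanged_except_refl)
  have bound: "eval_expr (Var ''n'') \<rho> = int n" if "I' k \<rho>" for k \<rho>
    using that frame[of k \<rho>] n by (simp add: I'_def)
  have "runs_within row_degree_program \<sigma> (8 + n * (19 + m * 50)) (I' n)"
    unfolding row_degree_program_def
    by (rule runs_within_mono[OF runs_within_for[of I' \<sigma> "''i''" n, OF init row bound]]) auto
  thus ?thesis by (rule runs_within_mono) (auto simp: I'_def I_def)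
qed

section \<open>The numbers of perfect matchings of complete graphs\<close>

definition pK_program :: com where
  "pK_program =
    Seq (Assign ''pK'' (Const 0) (Const 1))
    (For ''i'' (Plus (Var ''n'') (Var ''m''))
      (Assign ''pK'' (Plus (Var ''i'') (Const 2)) (Times (Plus (Var ''i'') (Const 1)) (Cell ''pK'' (Var ''i'')))))"

lemma pK_program_correct:
  assumes n: "\<sigma> ''n'' 0 = int n" and m: "\<sigma> ''m'' 0 = int m" and pK: "\<And>k. \<sigma> ''pK'' k = 0"
  shows "runs_within pK_program \<sigma> (14 + (n + m) * 30)
    (\<lambda>\<tau>. (\<forall>t\<le>n + m. \<tau> ''pK'' (int t) = int (pK t)) \<and> unchanged_except {''pK'', ''i''} \<sigma> \<tau>)"
proof -
  let ?S = "{''pK'', ''i''}"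
  \<comment> \<open>Round \<open>i\<close> writes cell \<open>i + 2\<close>, so the values up to
    \<open>Suc i\<close> are known before it. At the start this includes index 1, whose correct
    value 0 is the initial content.\<close>
  define I where "I = (\<lambda>i \<tau>. (\<forall>t\<le>Suc i. \<tau> ''pK'' (int t) = int (pK t)) \<and> unchanged_except ?S \<sigma> \<tau>)"
  have frame: "\<tau> ''n'' = \<sigma> ''n''" "\<tau> ''m'' = \<sigma> ''m''" if "I i \<tau>" for i \<tau>
    using that unchanged_exceptD[of ?S \<sigma> \<tau>] unfolding I_def by auto
  have "runs_within pK_program \<sigma> (3 + (11 + (n + m) * 30)) (I (n + m))"
    unfolding pK_program_def
  proof (rule runs_within_seq, rule runs_within_assign)
    let ?c = "Assign ''pK'' (Plus (Var ''i'') (Const 2)) (Times (Plus (Var ''i'') (Const 1)) (Cell ''pK'' (Var ''i'')))"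
    let ?\<tau>' = "\<sigma>(''pK'' := (\<sigma> ''pK'')(eval_expr (Const 0) \<sigma> := eval_expr (Const 1) \<sigma>))"
    have "runs_within (For ''i'' (Plus (Var ''n'') (Var ''m'')) ?c) ?\<tau>' (6 + 5 + (n + m) * (9 + 5 + 16)) (I (n + m))"
    proof (rule runs_within_mono[OF runs_within_for[of I, where N = "n + m" and b = 16]])
      show "I 0 (?\<tau>'(''i'' := (?\<tau>' ''i'')(0 := 0)))"
        using pK pK_rec(1,2) by (auto simp: I_def unchanged_except_upd unchanged_except_refl le_Suc_eq)
    next
      fix i \<tau> assume I: "I i \<tau>" and i: "\<tau> ''i'' 0 = int i"
      have *: "\<tau> ''pK'' (int i) = int (pK i)" using I by (auto simp: I_def)
      have "(int i + 1) * int (pK i) = int (pK (Suc (Suc i)))" by (simp add: pK_rec(3) algebra_simps)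
      thus "runs_within ?c \<tau> 16 (\<lambda>\<tau>'. \<tau>' ''i'' 0 = int i \<and> I (Suc i) (\<tau>'(''i'' := (\<tau>' ''i'')(0 := int i + 1))))"
        using I i * by (intro runs_within_assign) (auto simp: I_def unchanged_except_upd le_Suc_eq)
    next
      fix i \<tau> assume "I i \<tau>"
      thus "eval_expr (Plus (Var ''n'') (Var ''m'')) \<tau> = int (n + m)" using frame n m by simp
    qed auto
    thus "runs_within (For ''i'' (Plus (Var ''n'') (Var ''m'')) ?c) ?\<tau>' (11 + (n + m) * 30) (I (n + m))" by simp
  qed simp
  thus ?thesis by (rule runs_within_mono) (auto simp: I_def)
qed

section \<open>The counting programs\<close>

text \<open>For \<open>k \<ge> 1\<close> one has \<open>k + 1 \<le> 2 * k\<close>, whence the factor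
  4. The shift by 1 keeps the bound positive for \<open>k = 0\<close>, where the programs still take
  some steps.\<close>

lemma quadratic_bigo: "(\<lambda>k. real (c * (k + 1)\<^sup>2)) \<in> O(\<lambda>k. real k ^ 2)"
proof (rule bigoI[where c = "4 * real c"])
  show "\<forall>\<^sub>F k in sequentially. norm (real (c * (k + 1)\<^sup>2)) \<le> 4 * real c * norm (real k ^ 2)"
    unfolding eventually_sequentially
  proof (intro exI allI impI)
    fix k :: nat assume "1 \<le> k"
    hence "(k + 1)\<^sup>2 \<le> (2 * k)\<^sup>2" by (intro power_mono) auto
    hence "c * (k + 1)\<^sup>2 \<le> c * (4 * k\<^sup>2)" by (intro mult_left_mono) (auto simp: power_mult_distrib)
    hence "real (c * (k + 1)\<^sup>2) \<le> real (c * (4 * k\<^sup>2))" by (simp only: of_nat_le_iff)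
    thus "norm (real (c * (k + 1)\<^sup>2)) \<le> 4 * real c * norm (real k ^ 2)" by simp
  qed
qed

lemma table_program_matching_count:
  assumes "bipartite_graph A B C" and card: "card A = n" and "chain_ordering A C x"
    and n: "\<sigma> ''n'' 0 = int n" and deg: "\<And>i. i < n \<Longrightarrow> \<sigma> ''deg'' (int (Suc i)) = int (degree C (x (Suc i)))"
    and M: "\<And>k. \<sigma> ''M'' k = 0"
  shows "runs_within table_program \<sigma> (100 * (n + 1)\<^sup>2)
    (\<lambda>\<tau>. (\<forall>i\<le>n. \<forall>s\<le>n. \<tau> ''M'' (table_cell n i s) = int (matching_count B C x i s)) \<and>
      unchanged_except {''M'', ''i'', ''s''} \<sigma> \<tau>)"
proof (rule table_program_correct[where f = "\<lambda>i s. int (matching_count B C x i s)" and d = "\<lambda>i. int (degree C (x i))"])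
  show "int (matching_count B C x i 0) = 1" for i using matching_count_0[OF assms(1)] by simp
  show "int (matching_count B C x 0 (Suc s)) = 0" for s
    using matching_count_eq_0[OF assms(1,3), of 0] by simp
  show "int (matching_count B C x (Suc i) (Suc s)) = int (matching_count B C x i (Suc s)) +
      (int (degree C (x (Suc i))) - int s) * int (matching_count B C x i s)" if "i < n" for i s
    using matching_count_Suc[OF assms(1,3)] that card by simp
qed (use n deg M in auto)

text \<open>Phrased for any store with the required cells: it serves the input that supplies degrees
  and \<open>pK\<close>, and also the store that the earlier stages reach from the adjacency matrix.
  The constant is \<open>100 + 60\<close>, by \<open>n + 1 \<le> (n + 1)^2\<close>.\<close>

lemma perfect_matching_program_correct:
  assumes co: "cochain_graph A B F" and card: "card A = n" "card B = m"
    and ord: "chain_ordering A (cross_edges A B F) x"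
    and n: "\<sigma> ''n'' 0 = int n" and m: "\<sigma> ''m'' 0 = int m" and p: "\<sigma> ''p'' 0 = 0"
    and deg: "\<And>i. i < n \<Longrightarrow> \<sigma> ''deg'' (int (Suc i)) = int (degree (cross_edges A B F) (x (Suc i)))"
    and M: "\<And>k. \<sigma> ''M'' k = 0"
    and pK: "\<And>t. t \<le> max n m \<Longrightarrow> \<sigma> ''pK'' (int t) = int (pK t)"
  shows "runs_within (Seq table_program sum_program) \<sigma> (160 * (n + 1)\<^sup>2)
    (\<lambda>\<tau>. \<tau> ''p'' 0 = int (num_perfect_matchings (A \<union> B) F))"
proof -
  let ?C = "cross_edges A B F"
  have bip: "bipartite_graph A B ?C" using cochain_graph_structure(7)[OF co] unfolding chain_graph_def by auto
  have row: "matching_count B ?C x n s = num_matchings ?C s" for s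
    using matching_count_card[OF bip ord] card by simp
  have "runs_within (Seq table_program sum_program) \<sigma> (100 * (n + 1)\<^sup>2 + 60 * (n + 1))
    (\<lambda>\<tau>. \<tau> ''p'' 0 = int (num_perfect_matchings (A \<union> B) F))"
  proof (rule runs_within_seq, rule runs_within_mono[OF table_program_matching_count[OF bip card(1) ord n deg M] order_refl])
    fix \<tau>
    assume \<tau>: "(\<forall>i\<le>n. \<forall>s\<le>n. \<tau> ''M'' (table_cell n i s) = int (matching_count B ?C x i s)) \<and>
      unchanged_except {''M'', ''i'', ''s''} \<sigma> \<tau>"
    hence frame: "\<tau> ''n'' = \<sigma> ''n''" "\<tau> ''m'' = \<sigma> ''m''" "\<tau> ''p'' = \<sigma> ''p''" "\<tau> ''pK'' = \<sigma> ''pK''"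
      using unchanged_exceptD[of "{''M'', ''i'', ''s''}" \<sigma> \<tau>] by auto
    have "runs_within sum_program \<tau> (60 * (n + 1)) (\<lambda>\<rho>. \<rho> ''p'' 0 =
      (\<Sum>s = 0..min n m. int (num_matchings ?C s) * int (pK (n - s)) * int (pK (m - s))))"
    proof (rule sum_program_correct)
      show "\<tau> ''M'' (table_cell n n s) = int (num_matchings ?C s)" if "s \<le> n" for s
        using \<tau> that row by simp
      show "int (num_matchings ?C s) = 0" if "m < s" for s
        using num_matchings_eq_0[OF bip] that card by simp
    qed (use frame n m p pK in auto)
    thus "runs_within sum_program \<tau> (60 * (n + 1)) (\<lambda>\<rho>. \<rho> ''p'' 0 = int (num_perfect_matchings (A \<union> B) F))"
      by (simp add: num_perfect_matchings_cochain[OF co card])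
  qed
  thus ?thesis by (rule runs_within_mono) (auto simp: power2_eq_square algebra_simps)
qed

text \<open>A pair of a vertex below \<open>n\<close> and a vertex \<open>n + j\<close> lies inside
  neither side, so it is an edge of \<open>F\<close> exactly if it is a cross edge. Hence the matrix
  of the whole graph can be read without deleting the cliques.\<close>

lemma degree_chain_ordering_interval:
  assumes co: "cochain_graph {0..<n} {n..<n + m} F"
    and ord: "chain_ordering {0..<n} (cross_edges {0..<n} {n..<n + m} F) x" and i: "i < n"
  shows "degree (cross_edges {0..<n} {n..<n + m} F) (x (Suc i)) =
    card {j. j < m \<and> n - Suc i < card {u. u < n \<and> {u, n + j} \<in> F}}"
proof -
  let ?C = "cross_edges {0..<n} {n..<n + m} F"
  have bip: "bipartite_graph {0..<n} {n..<n + m} ?C"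
    using cochain_graph_structure(7)[OF co] unfolding chain_graph_def by auto
  have col: "{u. u < n \<and> {u, n + j} \<in> ?C} = {u. u < n \<and> {u, n + j} \<in> F}" for j
    unfolding cross_edges_def by auto
  have "{y \<in> {n..<n + m}. n - Suc i < card {u \<in> {0..<n}. {u, y} \<in> ?C}} =
    (+) n ` {j. j < m \<and> n - Suc i < card {u \<in> {0..<n}. {u, n + j} \<in> ?C}}" (is "?L = _ ` ?R")
  proof (intro equalityI subsetI)
    fix y assume y: "y \<in> ?L"
    hence "y = n + (y - n)" "y - n < m" by auto
    thus "y \<in> (+) n ` ?R" using y by (intro image_eqI[of _ _ "y - n"]) auto
  qed auto
  thus ?thesis
    using degree_chain_ordering[OF bip ord, of "Suc i"] i by (simp add: card_image col)
qed

definition adjacency_program :: com where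
  "adjacency_program = Seq column_degree_program (Seq row_degree_program
     (Seq pK_program (Seq table_program sum_program)))"

lemma adjacency_program_correct:
  assumes co: "cochain_graph {0..<n} {n..<n + m} F"
  shows "runs_within adjacency_program (adjacency_input n m F) (500 * (max n m + 1)\<^sup>2)
    (\<lambda>\<tau>. \<tau> ''p'' 0 = int (num_perfect_matchings {0..<n + m} F))"
proof -
  let ?A = "{0..<n}" and ?B = "{n..<n + m}"
  let ?\<sigma> = "adjacency_input n m F"
  let ?\<beta> = "\<lambda>j. card {i. i < n \<and> {i, n + j} \<in> F}"
  \<comment> \<open>The ordering exists only in the proof; the program finds the degrees along it
    without knowing it.\<close>
  obtain x where ord: "chain_ordering ?A (cross_edges ?A ?B F) x"
    using chain_ordering_exists[OF cochain_graph_structure(7)[OF co]] by auto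
  have init: "?\<sigma> ''n'' 0 = int n" "?\<sigma> ''m'' 0 = int m" "?\<sigma> ''b'' k = 0" "?\<sigma> ''deg'' k = 0"
    "?\<sigma> ''pK'' k = 0" "?\<sigma> ''M'' k = 0" "?\<sigma> ''p'' k = 0" for k
    by (simp_all add: adjacency_input_def scalar_input_def array_input_def zero_store_def)
  have adj: "?\<sigma> ''adj'' (int i * (int n + int m) + (int n + int j)) = (if {i, n + j} \<in> F then 1 else 0)"
    if "i < n" "j < m" for i j
  proof -
    let ?k = "(n + j) + i * (n + m)"
    have k: "int i * (int n + int m) + (int n + int j) = int ?k" by (simp add: algebra_simps)
    have dm: "?k div (n + m) = i" "?k mod (n + m) = n + j" using that by simp_all
    \<comment> \<open>Row \<open>i\<close> ends within the matrix, so the entry read lies in the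
      input range and not among the default zeros.\<close>
    have "Suc i * (n + m) \<le> (n + m) * (n + m)" using that by (intro mult_right_mono) auto
    hence lt: "?k < (n + m) * (n + m)" using that by simp
    have cell: "?\<sigma> ''adj'' (int k) = (if {k div (n + m), k mod (n + m)} \<in> F then 1 else 0)"
      if "k < (n + m) * (n + m)" for k
      using that by (simp add: adjacency_input_def scalar_input_def array_input_def)
    show ?thesis unfolding k cell[OF lt] dm ..
  qed
  let ?Q = "\<lambda>\<tau>. \<tau> ''p'' 0 = int (num_perfect_matchings {0..<n + m} F)"
  have "runs_within adjacency_program ?\<sigma> ((8 + m * (19 + n * 50)) + ((8 + n * (19 + m * 50)) +
    ((14 + (n + m) * 30) + 160 * (n + 1)\<^sup>2))) ?Q"
    unfolding adjacency_program_def
  proof (rule runs_within_seq, rule runs_within_mono[OF column_degree_program_correct[OF init(1-3) adj] order_refl])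
    fix \<tau>1
    assume "(\<forall>j<m. \<tau>1 ''b'' (int j) = int (?\<beta> j)) \<and> unchanged_except {''b'', ''i'', ''j''} ?\<sigma> \<tau>1"
    hence b: "\<And>j. j < m \<Longrightarrow> \<tau>1 ''b'' (int j) = int (?\<beta> j)"
      and u1: "\<And>a. a \<notin> {''b'', ''i'', ''j''} \<Longrightarrow> \<tau>1 a = ?\<sigma> a"
      using unchanged_exceptD by blast+
    have 1: "\<tau>1 ''n'' 0 = int n" "\<tau>1 ''m'' 0 = int m" "\<tau>1 ''deg'' k = 0" for k using u1 init by simp_all
    show "runs_within (Seq row_degree_program (Seq pK_program (Seq table_program sum_program))) \<tau>1
      ((8 + n * (19 + m * 50)) + ((14 + (n + m) * 30) + 160 * (n + 1)\<^sup>2)) ?Q"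
    proof (rule runs_within_seq, rule runs_within_mono[OF row_degree_program_correct[of \<tau>1 n m, OF 1 b] order_refl])
      fix \<tau>2
      assume "(\<forall>i<n. \<tau>2 ''deg'' (int (Suc i)) = int (card {j. j < m \<and> n - Suc i < ?\<beta> j})) \<and>
        unchanged_except {''deg'', ''i'', ''j''} \<tau>1 \<tau>2"
      hence deg: "\<And>i. i < n \<Longrightarrow> \<tau>2 ''deg'' (int (Suc i)) = int (card {j. j < m \<and> n - Suc i < ?\<beta> j})"
        and u2: "\<And>a. a \<notin> {''deg'', ''i'', ''j''} \<Longrightarrow> \<tau>2 a = \<tau>1 a"
        using unchanged_exceptD by blast+
      have 2: "\<tau>2 ''n'' 0 = int n" "\<tau>2 ''m'' 0 = int m" "\<tau>2 ''pK'' k = 0" for k using u1 u2 init by simp_all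
      show "runs_within (Seq pK_program (Seq table_program sum_program)) \<tau>2
        ((14 + (n + m) * 30) + 160 * (n + 1)\<^sup>2) ?Q"
      proof (rule runs_within_seq, rule runs_within_mono[OF pK_program_correct[of \<tau>2 n m, OF 2] order_refl])
        fix \<tau>3
        assume "(\<forall>t\<le>n + m. \<tau>3 ''pK'' (int t) = int (pK t)) \<and> unchanged_except {''pK'', ''i''} \<tau>2 \<tau>3"
        hence pK: "\<And>t. t \<le> n + m \<Longrightarrow> \<tau>3 ''pK'' (int t) = int (pK t)"
          and u3: "\<And>a. a \<notin> {''pK'', ''i''} \<Longrightarrow> \<tau>3 a = \<tau>2 a"
          using unchanged_exceptD by blast+
        have "runs_within (Seq table_program sum_program) \<tau>3 (160 * (n + 1)\<^sup>2)
          (\<lambda>\<tau>. \<tau> ''p'' 0 = int (num_perfect_matchings (?A \<union> ?B) F))"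
        proof (rule perfect_matching_program_correct[OF co _ _ ord])
          show "\<tau>3 ''deg'' (int (Suc i)) = int (degree (cross_edges ?A ?B F) (x (Suc i)))" if "i < n" for i
            using deg[OF that] u3 degree_chain_ordering_interval[OF co ord that] by simp
          show "\<tau>3 ''pK'' (int t) = int (pK t)" if "t \<le> max n m" for t using pK that by simp
        qed (use u1 u2 u3 init in simp_all)
        moreover have "?A \<union> ?B = {0..<n + m}" by auto
        ultimately show "runs_within (Seq table_program sum_program) \<tau>3 (160 * (n + 1)\<^sup>2) ?Q" by simp
      qed
    qed
  qed
  \<comment> \<open>With \<open>k = max n m\<close> the left side is at most
    \<open>260 * k^2 + 418 * k + 190\<close>.\<close>
  moreover have "(8 + m * (19 + n * 50)) + ((8 + n * (19 + m * 50)) +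
    ((14 + (n + m) * 30) + 160 * (n + 1)\<^sup>2)) \<le> 500 * (max n m + 1)\<^sup>2"
  proof -
    define k where "k = max n m"
    have k: "n \<le> k" "m \<le> k" unfolding k_def by auto
    have "n * m \<le> k * k" "n * n \<le> k * k" using k by (auto intro: mult_mono)
    thus ?thesis using k unfolding k_def[symmetric] by (simp add: power2_eq_square algebra_simps)
  qed
  ultimately show ?thesis by (rule runs_within_mono)
qed

theorem mainTheorem7:
  fixes X Y :: "'a set" and E :: "'a set set" and n m :: nat
  assumes "cochain_graph X Y E" and "card X = n" and "card Y = m"
  shows
    "clique E X \<and> clique E Y \<and> chain_graph X Y (cross_edges X Y E) \<and>
     num_perfect_matchings (X \<union> Y) E =
       (\<Sum>s = 0..min n m. num_matchings (cross_edges X Y E) s * pK (n - s) * pK (m - s)) \<and>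
     (\<exists>x. chain_ordering X (cross_edges X Y E) x) \<and>
     (\<forall>x. chain_ordering X (cross_edges X Y E) x \<longrightarrow>
       (let M = matching_count Y (cross_edges X Y E) x in
         (\<forall>s. M n s = num_matchings (cross_edges X Y E) s) \<and>
         (\<forall>i. i \<le> n \<longrightarrow> M i 0 = 1) \<and>
         (\<forall>i s. i < s \<and> s \<le> n \<longrightarrow> M i s = 0) \<and>
         (\<forall>i s. 1 \<le> s \<and> s \<le> i \<and> i \<le> n \<longrightarrow>
           int (M i s) = int (M (i - 1) s)
             + (int (degree (cross_edges X Y E) (x i)) - int s + 1) * int (M (i - 1) (s - 1))))) \<and>
     \<comment> \<open>All values \<open>M(i,s)\<close> from the degrees in time \<open>O(n\<^sup>2)\<close>.\<close>
     (\<exists>c T. (\<lambda>k. real (T k)) \<in> O(\<lambda>k. real k ^ 2) \<and>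
       (\<forall>(A :: nat set) (B :: nat set) F n x.
         cochain_graph A B F \<and> card A = n \<and> chain_ordering A (cross_edges A B F) x \<longrightarrow>
         runs_within c (degree_input n (\<lambda>i. degree (cross_edges A B F) (x i))) (T n)
           (\<lambda>\<tau>. \<forall>i\<le>n. \<forall>s\<le>n. \<tau> ''M'' (int i * (int n + 1) + int s) =
              int (matching_count B (cross_edges A B F) x i s)))) \<and>
     \<comment> \<open>\<open>p(G)\<close> from the degrees and the numbers \<open>p(K\<^sub>t)\<close> in time \<open>O(n\<^sup>2)\<close>.\<close>
     (\<exists>c T. (\<lambda>k. real (T k)) \<in> O(\<lambda>k. real k ^ 2) \<and>
       (\<forall>(A :: nat set) (B :: nat set) F n m x.
         cochain_graph A B F \<and> card A = n \<and> card B = m \<and>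
         chain_ordering A (cross_edges A B F) x \<longrightarrow>
         runs_within c (degree_pK_input n m (\<lambda>i. degree (cross_edges A B F) (x i))) (T n)
           (\<lambda>\<tau>. \<tau> ''p'' 0 = int (num_perfect_matchings (A \<union> B) F)))) \<and>
     \<comment> \<open>\<open>p(G)\<close> from the adjacency matrix alone, in quadratic time in the larger of \<open>n\<close>, \<open>m\<close>;
       this is \<open>O(n\<^sup>2)\<close> if \<open>X\<close> is the larger side.\<close>
     (\<exists>c T. (\<lambda>k. real (T k)) \<in> O(\<lambda>k. real k ^ 2) \<and>
       (\<forall>n m F. cochain_graph {0..<n} {n..<n + m} F \<longrightarrow>
         runs_within c (adjacency_input n m F) (T (max n m))
           (\<lambda>\<tau>. \<tau> ''p'' 0 = int (num_perfect_matchings {0..<n + m} F))))"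
proof (intro conjI)
  note st = cochain_graph_structure[OF assms(1)]
  let ?C = "cross_edges X Y E"
  have bip: "bipartite_graph X Y ?C" using st(7) unfolding chain_graph_def by auto
  have "clique E V" if "vpairs V \<subseteq> E" for V
    unfolding clique_def by (intro ballI impI subsetD[OF that]) (simp add: vpairs_def)
  thus "clique E X" "clique E Y" using st(4,5) by auto
  show "chain_graph X Y ?C" by (rule st(7))
  show "num_perfect_matchings (X \<union> Y) E = (\<Sum>s = 0..min n m. num_matchings ?C s * pK (n - s) * pK (m - s))"
    by (rule num_perfect_matchings_cochain[OF assms])
  show "\<exists>x. chain_ordering X ?C x" by (rule chain_ordering_exists[OF st(7)])
  show "\<forall>x. chain_ordering X ?C x \<longrightarrow>
       (let M = matching_count Y ?C x in
         (\<forall>s. M n s = num_matchings ?C s) \<and>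
         (\<forall>i. i \<le> n \<longrightarrow> M i 0 = 1) \<and>
         (\<forall>i s. i < s \<and> s \<le> n \<longrightarrow> M i s = 0) \<and>
         (\<forall>i s. 1 \<le> s \<and> s \<le> i \<and> i \<le> n \<longrightarrow>
           int (M i s) = int (M (i - 1) s)
             + (int (degree ?C (x i)) - int s + 1) * int (M (i - 1) (s - 1))))"
  proof (intro allI impI)
    fix x assume ord: "chain_ordering X ?C x"
    have "int (matching_count Y ?C x i s) = int (matching_count Y ?C x (i - 1) s)
             + (int (degree ?C (x i)) - int s + 1) * int (matching_count Y ?C x (i - 1) (s - 1))"
      if "1 \<le> s \<and> s \<le> i \<and> i \<le> n" for i s
    proof -
      \<comment> \<open>Passage from the successor form back to the recurrence as stated;
        \<open>s \<ge> 1\<close> makes the predecessor of \<open>s\<close> exact in the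
        integers.\<close>
      have "Suc (i - 1) = i" "Suc (s - 1) = s" "i - 1 < card X" "int (s - 1) = int s - 1"
        using that assms(2) by auto
      thus ?thesis using matching_count_Suc[OF bip ord, of "i - 1" "s - 1"] by simp
    qed
    thus "let M = matching_count Y ?C x in
         (\<forall>s. M n s = num_matchings ?C s) \<and>
         (\<forall>i. i \<le> n \<longrightarrow> M i 0 = 1) \<and>
         (\<forall>i s. i < s \<and> s \<le> n \<longrightarrow> M i s = 0) \<and>
         (\<forall>i s. 1 \<le> s \<and> s \<le> i \<and> i \<le> n \<longrightarrow>
           int (M i s) = int (M (i - 1) s)
             + (int (degree ?C (x i)) - int s + 1) * int (M (i - 1) (s - 1)))"
      unfolding Let_def
      using matching_count_card[OF bip ord] matching_count_0[OF bip] matching_count_eq_0[OF bip ord] assms(2)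
      by auto
  qed
next
  let ?T = "\<lambda>n. 100 * (n + 1)\<^sup>2"
  have "runs_within table_program (degree_input n (\<lambda>i. degree (cross_edges A B F) (x i))) (?T n)
           (\<lambda>\<tau>. \<forall>i\<le>n. \<forall>s\<le>n. \<tau> ''M'' (int i * (int n + 1) + int s) =
              int (matching_count B (cross_edges A B F) x i s))"
    if A: "cochain_graph A B F \<and> card A = n \<and> chain_ordering A (cross_edges A B F) x"
    for A B :: "nat set" and F n x
  proof -
    let ?C = "cross_edges A B F"
    have bip: "bipartite_graph A B ?C"
      using A cochain_graph_structure(7)[of A B F] unfolding chain_graph_def by auto
    have "runs_within table_program (degree_input n (\<lambda>i. degree ?C (x i))) (?T n)
      (\<lambda>\<tau>. (\<forall>i\<le>n. \<forall>s\<le>n. \<tau> ''M'' (table_cell n i s) = int (matching_count B ?C x i s)) \<and>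
      unchanged_except {''M'', ''i'', ''s''} (degree_input n (\<lambda>i. degree ?C (x i))) \<tau>)"
      by (rule table_program_matching_count[OF bip])
        (use A in \<open>auto simp: degree_input_def scalar_input_def array_input_def zero_store_def nat_add_distrib\<close>)
    thus ?thesis by (rule runs_within_mono) (auto simp: table_cell_def)
  qed
  thus "\<exists>c T. (\<lambda>k. real (T k)) \<in> O(\<lambda>k. real k ^ 2) \<and>
       (\<forall>(A :: nat set) (B :: nat set) F n x.
         cochain_graph A B F \<and> card A = n \<and> chain_ordering A (cross_edges A B F) x \<longrightarrow>
         runs_within c (degree_input n (\<lambda>i. degree (cross_edges A B F) (x i))) (T n)
           (\<lambda>\<tau>. \<forall>i\<le>n. \<forall>s\<le>n. \<tau> ''M'' (int i * (int n + 1) + int s) =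
              int (matching_count B (cross_edges A B F) x i s)))"
    by (intro exI[of _ table_program] exI[of _ ?T] conjI quadratic_bigo) blast
next
  let ?T = "\<lambda>n. 160 * (n + 1)\<^sup>2"
  have "runs_within (Seq table_program sum_program)
      (degree_pK_input n m (\<lambda>i. degree (cross_edges A B F) (x i))) (?T n)
           (\<lambda>\<tau>. \<tau> ''p'' 0 = int (num_perfect_matchings (A \<union> B) F))"
    if A: "cochain_graph A B F \<and> card A = n \<and> card B = m \<and> chain_ordering A (cross_edges A B F) x"
    for A B :: "nat set" and F n m x
    by (rule perfect_matching_program_correct[of A B F n m x])
      (use A in \<open>auto simp: degree_pK_input_def degree_input_def scalar_input_def array_input_def
        zero_store_def nat_add_distrib\<close>)
  thus "\<exists>c T. (\<lambda>k. real (T k)) \<in> O(\<lambda>k. real k ^ 2) \<and>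
       (\<forall>(A :: nat set) (B :: nat set) F n m x.
         cochain_graph A B F \<and> card A = n \<and> card B = m \<and>
         chain_ordering A (cross_edges A B F) x \<longrightarrow>
         runs_within c (degree_pK_input n m (\<lambda>i. degree (cross_edges A B F) (x i))) (T n)
           (\<lambda>\<tau>. \<tau> ''p'' 0 = int (num_perfect_matchings (A \<union> B) F)))"
    by (intro exI[of _ "Seq table_program sum_program"] exI[of _ ?T] conjI quadratic_bigo) blast
next
  show "\<exists>c T. (\<lambda>k. real (T k)) \<in> O(\<lambda>k. real k ^ 2) \<and>
       (\<forall>n m F. cochain_graph {0..<n} {n..<n + m} F \<longrightarrow>
         runs_within c (adjacency_input n m F) (T (max n m))
           (\<lambda>\<tau>. \<tau> ''p'' 0 = int (num_perfect_matchings {0..<n + m} F)))"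
    using adjacency_program_correct
    by (intro exI[of _ adjacency_program] exI[of _ "\<lambda>k. 500 * (k + 1)\<^sup>2"] conjI quadratic_bigo) blast
qed

end
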